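(* Let $\mathbf P$ be a finite poset, $M\in\operatorname{mod}\Bbbk[\mathbf P]$, and $I$ an interval of $\mathbf P$. Let $\zeta\colon Z\to\mathbf P$ be an order-preserving map with $Z$ a poset, and let $R\colon\operatorname{mod}\Bbbk[\mathbf P]\to\operatorname{mod}\Bbbk[Z]$ be the restriction functor induced by $\zeta$. If $\zeta$ essentially covers $I$, then $$d_M(V_I)=\bar d_{R(M)}(R(V_I)).$$
   Context: $\Bbbk$ is a field. A poset $S$ is regarded as a category with exactly one morphism $p_{y,x}\colon x\to y$ when $x\le y$ and none otherwise; $\Bbbk[S]$ is its $\Bbbk$-linearization ($\Bbbk[S](x,y)=\Bbbk p_{y,x}$ if $x\le y$, $0$ otherwise), and $\operatorname{mod}\Bbbk[S]$ is the category of $\Bbbk$-linear functors from $\Bbbk[S]$ to finite-dimensional $\Bbbk$-vector spaces. An order-preserving map $\zeta\colon Z\to\mathbf P$ extends to a linear functor $\Bbbk[\zeta]\colon\Bbbk[Z]\to\Bbbk[\mathbf P]$, $p_{y,x}\mapsto p_{\zeta(y),\zeta(x)}$, and $R(M):=M\circ\Bbbk[\zeta]$. An interval of $\mathbf P$ is a nonempty full subposet $I$ that is connected (any two elements are joined by a sequence of consecutively comparable elements of $I$) and convex. The interval module $V_I$ has $V_I(x)=\Bbbk$ for $x\in I$, $0$ otherwise, with identity structure maps between elements $x\le y$ of $I$ and zero structure maps otherwise. $d_M(V_I)$ is the multiplicity of the indecomposable $V_I$ in a decomposition of $M$ into indecomposables. For modules $N,L$: if $N\cong L^n\oplus N'$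 with $n\ge0$ and $N'$ having no direct summand isomorphic to $L$, then $\bar d_N(L):=n$. Formal additive hull: for a linear category $B$, $\bigoplus B$ has as objects finite (possibly empty) sequences $(x_i)_{i\in[m]}$ of objects of $B$; a morphism $(x_i)_{i\in[m]}\to(y_j)_{j\in[n]}$ is a matrix $[\alpha_{ji}]_{(j,i)\in[n]\times[m]}$ with $\alpha_{ji}\in B(x_i,y_j)$ (empty matrices allowed); composition is matrix multiplication. Direct sum of objects is concatenation. For a functor $M\colon\Bbbk[\mathbf P]\to\operatorname{mod}\Bbbk$ and a morphism $\alpha=[\alpha_{ji}]$ in $\bigoplus\Bbbk[\mathbf P]$, $M(\alpha):=[M(\alpha_{ji})]_{j,i}\colon\bigoplus_iM(x_i)\to\bigoplus_jM(y_j)$. For a morphism $\alpha'=[\alpha'_{ji}]$ in $\bigoplus\Bbbk[Z]$, $\zeta(\alpha'):=[\Bbbk[\zeta](\alpha'_{ji})]_{j,i}$, a morphism in $\bigoplus\Bbbk[\mathbf P]$. $\zeta$ covers a morphism $\alpha$ of $\bigoplus\Bbbk[\mathbf P]$ if there is a morphism $\alpha'$ of $\bigoplus\Bbbk[Z]$ with $\zeta(\alpha')=\alpha$. A multiplicity matrix for $I$ is a morphism $\boldsymbol g=\begin{bmatrix}\boldsymbol g_1 & \mathbf 0 \\ \boldsymbol g_3 & \boldsymbol g_2\end{bmatrix}\colon X\oplus X'\to Y\oplus Y'$ in $\bigoplus\Bbbk[\mathbf P]$ such that for every $M\in\operatorname{mod}\Bbbk[\mathbf P]$ $$d_M(V_I)=\operatorname{rank}\begin{bmatrix}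 M(\boldsymbol g_1) & \mathbf 0 \\ M(\boldsymbol g_3) & M(\boldsymbol g_2)\end{bmatrix}-\operatorname{rank}\begin{bmatrix} M(\boldsymbol g_1) & \mathbf 0 \\ \mathbf 0 & M(\boldsymbol g_2)\end{bmatrix}$$ (any of the blocks may be empty). $\zeta$ essentially covers $I$ if $\zeta$ covers some multiplicity matrix for $I$. *)

theory Defs
  imports
    "Jordan_Normal_Form.Matrix"
    "HOL-Library.Function_Algebras"
    "HOL-Library.Product_Plus"
begin

section \<open>The linearization of a poset and its modules\<close>

text \<open>
  A poset is a type of class \<open>order\<close>.  The scalar \<open>c \<in> khom x y\<close> stands for the morphism
  \<open>c p\<close>, where \<open>p : x \<rightarrow> y\<close> is the unique poset morphism if \<open>x \<le> y\<close>.  Hence composition of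
  morphisms is multiplication of scalars, and the identity of \<open>x\<close> is \<open>1\<close>.
\<close>

definition khom :: "'s::order \<Rightarrow> 's \<Rightarrow> 'k::field set" where
  "khom x y = (if x \<le> y then UNIV else {0})"

definition linmap ::
  "('k \<Rightarrow> 'v \<Rightarrow> 'v) \<Rightarrow> 'v set \<Rightarrow> ('k \<Rightarrow> 'w \<Rightarrow> 'w) \<Rightarrow> 'w set \<Rightarrow>
    ('v::ab_group_add \<Rightarrow> 'w::ab_group_add) \<Rightarrow> bool" where
  "linmap s V t W f \<longleftrightarrow>
     (\<forall>v\<in>V. f v \<in> W) \<and>
     (\<forall>v\<in>V. \<forall>w\<in>V. f (v + w) = f v + f w) \<and>
     (\<forall>c. \<forall>v\<in>V. f (s c v) = t c (f v))"

text \<open>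
  All the spaces \<open>obj M x\<close> are subspaces of one vector space of arbitrary dimension, the type
  \<open>'v\<close> with scalar multiplication \<open>scl M\<close>; \<open>arr M x y \<alpha>\<close> is the value of the functor at the
  morphism \<open>\<alpha>\<close>, and it is only meaningful for \<open>\<alpha> \<in> khom x y\<close> and on \<open>obj M x\<close>.
\<close>

record ('k, 'v, 's) kmod =
  scl :: "'k \<Rightarrow> 'v \<Rightarrow> 'v"
  obj :: "'s \<Rightarrow> 'v set"
  arr :: "'s \<Rightarrow> 's \<Rightarrow> 'k \<Rightarrow> 'v \<Rightarrow> 'v"

definition is_kmod :: "('k::field, 'v::ab_group_add, 's::order) kmod \<Rightarrow> bool" where
  "is_kmod M \<longleftrightarrow>
     vector_space (scl M) \<and>
     (\<forall>x. \<exists>B. finite B \<and> obj M x = Modules.module.span (scl M) B) \<and>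
     (\<forall>x y. \<forall>\<alpha>\<in>khom x y. linmap (scl M) (obj M x) (scl M) (obj M y) (arr M x y \<alpha>)) \<and>
     (\<forall>x y. \<forall>\<alpha>\<in>khom x y. \<forall>\<beta>\<in>khom x y. \<forall>v\<in>obj M x.
        arr M x y (\<alpha> + \<beta>) v = arr M x y \<alpha> v + arr M x y \<beta> v) \<and>
     (\<forall>x y c. \<forall>\<alpha>\<in>khom x y. \<forall>v\<in>obj M x. arr M x y (c * \<alpha>) v = scl M c (arr M x y \<alpha> v)) \<and>
     (\<forall>x. \<forall>v\<in>obj M x. arr M x x 1 v = v) \<and>
     (\<forall>x y z. \<forall>\<alpha>\<in>khom x y. \<forall>\<beta>\<in>khom y z. \<forall>v\<in>obj M x.
        arr M x z (\<beta> * \<alpha>) v = arr M y z \<beta> (arr M x y \<alpha> v))"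

definition kmod_iso ::
  "('k::field, 'v::ab_group_add, 's::order) kmod \<Rightarrow> ('k, 'w::ab_group_add, 's) kmod \<Rightarrow> bool" where
  "kmod_iso M N \<longleftrightarrow>
     (\<exists>\<eta>. (\<forall>x. linmap (scl M) (obj M x) (scl N) (obj N x) (\<eta> x) \<and>
               bij_betw (\<eta> x) (obj M x) (obj N x)) \<and>
          (\<forall>x y. \<forall>\<alpha>\<in>khom x y. \<forall>v\<in>obj M x. \<eta> y (arr M x y \<alpha> v) = arr N x y \<alpha> (\<eta> x v)))"

definition kmod_zero :: "('k, 'v::zero, 's) kmod \<Rightarrow> bool" where
  "kmod_zero M \<longleftrightarrow> (\<forall>x. obj M x = {0})"


section \<open>Direct sums, indecomposables and multiplicities\<close>

definition dsum2 ::
  "('k, 'v, 's) kmod \<Rightarrow> ('k, 'w, 's) kmod \<Rightarrow> ('k, 'v \<times> 'w, 's) kmod" where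
  "dsum2 M N =
     \<lparr>scl = (\<lambda>c (v, w). (scl M c v, scl N c w)),
      obj = (\<lambda>x. obj M x \<times> obj N x),
      arr = (\<lambda>x y \<alpha> (v, w). (arr M x y \<alpha> v, arr N x y \<alpha> w))\<rparr>"

text \<open>
  \<open>dsum m N\<close> is the direct sum of \<open>N 0, \<dots>, N (m - 1)\<close>; its vectors are tuples padded with zeros.
  The later \<open>N i\<close> only supply the scalar multiplication of the surrounding vector space.
\<close>

definition dsum :: "nat \<Rightarrow> (nat \<Rightarrow> ('k, 'v::zero, 's) kmod) \<Rightarrow> ('k, nat \<Rightarrow> 'v, 's) kmod" where
  "dsum m N =
     \<lparr>scl = (\<lambda>c v i. scl (N i) c (v i)),
      obj = (\<lambda>x. {v. (\<forall>i<m. v i \<in> obj (N i) x) \<and> (\<forall>i\<ge>m. v i = 0)}),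
      arr = (\<lambda>x y \<alpha> v i. if i < m then arr (N i) x y \<alpha> (v i) else 0)\<rparr>"

text \<open>
  In the definitions below, the summands of a module over the type \<open>'v\<close> are taken over \<open>'v\<close> too.
  This is no restriction, since a direct summand is isomorphic to a submodule.
\<close>

definition indecomposable :: "('k::field, 'v::ab_group_add, 's::order) kmod \<Rightarrow> bool" where
  "indecomposable M \<longleftrightarrow>
     is_kmod M \<and> \<not> kmod_zero M \<and>
     (\<forall>(A :: ('k, 'v, 's) kmod) (B :: ('k, 'v, 's) kmod).
        is_kmod A \<longrightarrow> is_kmod B \<longrightarrow> kmod_iso M (dsum2 A B) \<longrightarrow> kmod_zero A \<or> kmod_zero B)"

definition summand ::
  "('k::field, 'w::ab_group_add, 's::order) kmod \<Rightarrow> ('k, 'v::ab_group_add, 's) kmod \<Rightarrow> bool" where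
  "summand L N \<longleftrightarrow> (\<exists>N' :: ('k, 'v, 's) kmod. is_kmod N' \<and> kmod_iso N (dsum2 L N'))"

text \<open>The multiplicity \<open>d\<^sub>M(L)\<close> of an indecomposable \<open>L\<close>; unique by the Krull-Schmidt theorem.\<close>

definition summand_mult ::
  "('k::field, 'v::ab_group_add, 's::order) kmod \<Rightarrow> ('k, 'w::ab_group_add, 's) kmod \<Rightarrow> nat" where
  "summand_mult M L =
     (THE n. \<exists>m (N :: nat \<Rightarrow> ('k, 'v, 's) kmod).
        (\<forall>i. is_kmod (N i)) \<and> (\<forall>i<m. indecomposable (N i)) \<and> kmod_iso M (dsum m N) \<and>
        n = card {i. i < m \<and> kmod_iso (N i) L})"

text \<open>The number \<open>n\<close> with \<open>N \<cong> L\<^sup>n \<oplus> N'\<close> where \<open>L\<close> is not a direct summand of \<open>N'\<close>.\<close>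

definition bar_summand_mult ::
  "('k::field, 'v::ab_group_add, 's::order) kmod \<Rightarrow> ('k, 'w::ab_group_add, 's) kmod \<Rightarrow> nat" where
  "bar_summand_mult N L =
     (THE n. \<exists>N' :: ('k, 'v, 's) kmod.
        is_kmod N' \<and> kmod_iso N (dsum2 (dsum n (\<lambda>_. L)) N') \<and> \<not> summand L N')"


section \<open>Intervals and restriction\<close>

definition poset_connected :: "'s::order set \<Rightarrow> bool" where
  "poset_connected I \<longleftrightarrow>
     (\<forall>x\<in>I. \<forall>y\<in>I. (x, y) \<in> {(a, b). a \<in> I \<and> b \<in> I \<and> (a \<le> b \<or> b \<le> a)}\<^sup>*)"

definition poset_convex :: "'s::order set \<Rightarrow> bool" where
  "poset_convex I \<longleftrightarrow> (\<forall>x\<in>I. \<forall>z\<in>I. \<forall>y. x \<le> y \<longrightarrow> y \<le> z \<longrightarrow> y \<in> I)"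

definition interval :: "'s::order set \<Rightarrow> bool" where
  "interval I \<longleftrightarrow> I \<noteq> {} \<and> poset_connected I \<and> poset_convex I"

definition interval_module :: "'s::order set \<Rightarrow> ('k::field, 'k, 's) kmod" where
  "interval_module I =
     \<lparr>scl = (*),
      obj = (\<lambda>x. if x \<in> I then UNIV else {0}),
      arr = (\<lambda>x y \<alpha> v. if x \<in> I \<and> y \<in> I then \<alpha> * v else 0)\<rparr>"

lemma is_kmod_interval_module:
  assumes "interval I"
  shows "is_kmod (interval_module I :: ('k::field, 'k, 's::order) kmod)"
proof -
  let ?V = "interval_module I :: ('k, 'k, 's) kmod"
  interpret v: vector_space "(*) :: 'k \<Rightarrow> 'k \<Rightarrow> 'k"
    by unfold_locales (simp_all add: algebra_simps)
  have 0: "vector_space (scl ?V)"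
    using v.vector_space_axioms by (simp add: interval_module_def)
  have "(UNIV :: 'k set) = v.span {1}"
    by (simp add: v.span_singleton)
  then have "\<exists>B. finite B \<and> (UNIV :: 'k set) = v.span B"
    by (intro exI[of _ "{1}"]) simp
  moreover have "\<exists>B. finite B \<and> ({0} :: 'k set) = v.span B"
    by (intro exI[of _ "{}"]) simp
  ultimately have 1: "\<exists>B. finite B \<and> obj ?V x = v.span B" for x
    by (simp add: interval_module_def)
  have 2: "arr ?V x z (\<beta> * \<alpha>) v = arr ?V y z \<beta> (arr ?V x y \<alpha> v)"
    if "\<alpha> \<in> khom x y" "\<beta> \<in> khom y z" for x y z :: 's and \<alpha> \<beta> v :: 'k
  proof (cases "x \<in> I \<and> z \<in> I \<and> y \<notin> I")
    case True
    then have "\<not> (x \<le> y \<and> y \<le> z)"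
      using assms by (metis interval_def poset_convex_def)
    then have "\<alpha> = 0 \<or> \<beta> = 0"
      using that by (cases "x \<le> y") (simp_all add: khom_def)
    then show ?thesis
      by (elim disjE) (simp_all add: interval_module_def)
  next
    case False
    then show ?thesis
      by (simp add: interval_module_def)
  qed
  have 3: "linmap (scl ?V) (obj ?V x) (scl ?V) (obj ?V y) (arr ?V x y \<alpha>)" for x y \<alpha>
    unfolding linmap_def interval_module_def kmod.simps
    by (cases "x \<in> I"; cases "y \<in> I") (simp_all add: distrib_left mult.left_commute)
  have 4: "arr ?V x y (\<alpha> + \<beta>) v = arr ?V x y \<alpha> v + arr ?V x y \<beta> v"
    "arr ?V x y (c * \<alpha>) v = scl ?V c (arr ?V x y \<alpha> v)" for x y \<alpha> \<beta> c v
    by (simp_all add: interval_module_def distrib_right)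
  have 5: "arr ?V x x 1 v = v" if "v \<in> obj ?V x" for x v
    using that by (simp add: interval_module_def split: if_splits)
  show ?thesis
    unfolding is_kmod_def
  proof (intro conjI allI ballI)
    show "\<exists>B. finite B \<and> obj ?V x = Modules.module.span (scl ?V) B" for x
      using 1 by (simp add: interval_module_def)
  qed (rule 0 3 4 5 2, assumption+ | rule 0 3 4)+
qed

text \<open>
  Precomposition with the linearization of \<open>\<zeta>\<close>, which sends \<open>c p : x \<rightarrow> y\<close> to
  \<open>c p : \<zeta> x \<rightarrow> \<zeta> y\<close> and thus keeps the scalar.
\<close>

definition restrict_kmod :: "('z \<Rightarrow> 'p) \<Rightarrow> ('k, 'v, 'p) kmod \<Rightarrow> ('k, 'v, 'z) kmod" where
  "restrict_kmod \<zeta> M =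
     \<lparr>scl = scl M, obj = (\<lambda>x. obj M (\<zeta> x)), arr = (\<lambda>x y \<alpha>. arr M (\<zeta> x) (\<zeta> y) \<alpha>)\<rparr>"

lemma is_kmod_restrict_kmod:
  fixes M :: "('k::field, 'v::ab_group_add, 'p::order) kmod" and \<zeta> :: "'z::order \<Rightarrow> 'p"
  assumes "is_kmod M" "mono \<zeta>"
  shows "is_kmod (restrict_kmod \<zeta> M)"
proof -
  have h: "\<alpha> \<in> khom (\<zeta> x) (\<zeta> y)" if "\<alpha> \<in> khom x y" for \<alpha> :: 'k and x y
    using that monoD[OF assms(2), of x y] by (cases "x \<le> y") (simp_all add: khom_def)
  show ?thesis
    using assms(1) unfolding is_kmod_def restrict_kmod_def kmod.simps by (simp add: h)
qed


section \<open>The formal additive hull\<close>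

record ('k, 's) hmor =
  hdom :: "'s list"
  hcod :: "'s list"
  hmat :: "'k mat"

definition is_hmor :: "('k::field, 's::order) hmor \<Rightarrow> bool" where
  "is_hmor a \<longleftrightarrow>
     hmat a \<in> carrier_mat (length (hcod a)) (length (hdom a)) \<and>
     (\<forall>j < length (hcod a). \<forall>i < length (hdom a). hmat a $$ (j, i) \<in> khom (hdom a ! i) (hcod a ! j))"

definition hull_obj :: "('k, 'v::zero, 's) kmod \<Rightarrow> 's list \<Rightarrow> (nat \<Rightarrow> 'v) set" where
  "hull_obj M X =
     {v. (\<forall>i < length X. v i \<in> obj M (X ! i)) \<and> (\<forall>i \<ge> length X. v i = 0)}"

definition hull_map ::
  "('k, 'v::comm_monoid_add, 's) kmod \<Rightarrow> ('k, 's) hmor \<Rightarrow> (nat \<Rightarrow> 'v) \<Rightarrow> nat \<Rightarrow> 'v" where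
  "hull_map M a v =
     (\<lambda>j. if j < length (hcod a)
           then \<Sum>i < length (hdom a). arr M (hdom a ! i) (hcod a ! j) (hmat a $$ (j, i)) (v i)
           else 0)"

definition hull_rank :: "('k::field, 'v::ab_group_add, 's) kmod \<Rightarrow> ('k, 's) hmor \<Rightarrow> nat" where
  "hull_rank M a =
     vector_space.dim (\<lambda>c v i. scl M c (v i)) (hull_map M a ` hull_obj M (hdom a))"

definition hull_push :: "('z \<Rightarrow> 'p) \<Rightarrow> ('k, 'z) hmor \<Rightarrow> ('k, 'p) hmor" where
  "hull_push \<zeta> a = \<lparr>hdom = map \<zeta> (hdom a), hcod = map \<zeta> (hcod a), hmat = hmat a\<rparr>"

definition covers :: "('z::order \<Rightarrow> 'p::order) \<Rightarrow> ('k::field, 'p) hmor \<Rightarrow> bool" where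
  "covers \<zeta> a \<longleftrightarrow> (\<exists>a' :: ('k, 'z) hmor. is_hmor a' \<and> hull_push \<zeta> a' = a)"


section \<open>Multiplicity matrices and essential covering\<close>

text \<open>The morphism with blocks \<open>[g\<^sub>1, 0; g\<^sub>3, g\<^sub>2] : X \<oplus> X' \<rightarrow> Y \<oplus> Y'\<close>.\<close>

definition lower_block ::
  "'s list \<Rightarrow> 's list \<Rightarrow> 's list \<Rightarrow> 's list \<Rightarrow> 'k mat \<Rightarrow> 'k mat \<Rightarrow> 'k mat \<Rightarrow> ('k::zero, 's) hmor"
  where
  "lower_block X X' Y Y' g\<^sub>1 g\<^sub>3 g\<^sub>2 =
     \<lparr>hdom = X @ X', hcod = Y @ Y',
      hmat = four_block_mat g\<^sub>1 (0\<^sub>m (length Y) (length X')) g\<^sub>3 g\<^sub>2\<rparr>"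

text \<open>
  The modules \<open>M\<close> are taken over the type \<open>nat \<Rightarrow> 'k\<close>, which has infinite dimension for its
  pointwise scalar multiplication, so that every module occurs up to isomorphism.
\<close>

definition multiplicity_matrix ::
  "'p::order set \<Rightarrow> 'p list \<Rightarrow> 'p list \<Rightarrow> 'p list \<Rightarrow> 'p list \<Rightarrow>
    'k mat \<Rightarrow> 'k mat \<Rightarrow> 'k::field mat \<Rightarrow> bool" where
  "multiplicity_matrix I X X' Y Y' g\<^sub>1 g\<^sub>3 g\<^sub>2 \<longleftrightarrow>
     g\<^sub>1 \<in> carrier_mat (length Y) (length X) \<and>
     g\<^sub>3 \<in> carrier_mat (length Y') (length X) \<and>
     g\<^sub>2 \<in> carrier_mat (length Y') (length X') \<and>
     is_hmor (lower_block X X' Y Y' g\<^sub>1 g\<^sub>3 g\<^sub>2) \<and>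
     (\<forall>M :: ('k, nat \<Rightarrow> 'k, 'p) kmod. is_kmod M \<longrightarrow>
        int (summand_mult M (interval_module I :: ('k, 'k, 'p) kmod)) =
          int (hull_rank M (lower_block X X' Y Y' g\<^sub>1 g\<^sub>3 g\<^sub>2)) -
          int (hull_rank M (lower_block X X' Y Y' g\<^sub>1 (0\<^sub>m (length Y') (length X)) g\<^sub>2)))"

definition essentially_covers ::
  "'k::field itself \<Rightarrow> ('z::order \<Rightarrow> 'p::order) \<Rightarrow> 'p set \<Rightarrow> bool" where
  "essentially_covers TYPE('k) \<zeta> I \<longleftrightarrow>
     (\<exists>X X' Y Y' (g\<^sub>1 :: 'k mat) g\<^sub>3 g\<^sub>2.
        multiplicity_matrix I X X' Y Y' g\<^sub>1 g\<^sub>3 g\<^sub>2 \<and>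
        covers \<zeta> (lower_block X X' Y Y' g\<^sub>1 g\<^sub>3 g\<^sub>2))"

end

theory Submission
  imports Defs "Jordan_Normal_Form.Determinant"
begin

text \<open>
  For a module \<open>A\<close> of the form \<open>interval_module S\<close>, the numbers \<open>n\<close> such that \<open>A\<^sup>n\<close> is a direct summand
  of \<open>N\<close> determine both multiplicities.  Indeed, if \<open>A\<close> is not a summand of \<open>N'\<close>, then at some point
  \<open>x\<^sub>0\<close> of \<open>S\<close> all composites \<open>A \<rightarrow> N' \<rightarrow> A\<close> vanish; evaluating at \<open>x\<^sub>0\<close>, a summand \<open>A\<^sup>m\<close> of
  \<open>A\<^sup>n \<oplus> N'\<close> factors the identity matrix of size \<open>m\<close> through \<open>k\<^sup>n\<close>, so \<open>m \<le> n\<close>.  This replaces the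
  Krull-Schmidt theorem, which matters because \<open>Z\<close> may be infinite.

  Write \<open>M \<cong> V\<^sub>I\<^sup>d \<oplus> M'\<close> with \<open>d = d\<^sub>M(V\<^sub>I)\<close>.  It remains to see that \<open>R(V\<^sub>I)\<close> is not a summand of
  \<open>R(M')\<close>.  For a multiplicity matrix with full morphism \<open>a\<close> and block diagonal part \<open>b\<close>, the two
  ranks on a module agree iff \<open>a\<close> maps the kernel of \<open>b\<close> into the image of \<open>b\<close>.  This condition is
  inherited by retracts, and it can be tested on the restriction with a lift of \<open>a\<close> and \<open>b\<close>.
  It holds for \<open>M'\<close> and fails for \<open>V\<^sub>I\<close>.
\<close>


section \<open>Finite-dimensional subspaces\<close>

text \<open>The ambient space may have infinite dimension, so finiteness is attached to the set;
  this is the clause on \<open>obj M x\<close> in \<open>is_kmod\<close>, and it makes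
  \<open>V\<close> a subspace.\<close>

definition fin_dim :: "('k::field \<Rightarrow> 'v \<Rightarrow> 'v) \<Rightarrow> 'v::ab_group_add set \<Rightarrow> bool" where
  "fin_dim s V \<longleftrightarrow> (\<exists>B. finite B \<and> V = module.span s B)"

context vector_space
begin

lemma fin_dim_subspace: "fin_dim scale V \<Longrightarrow> subspace V"
  by (auto simp: fin_dim_def)

lemma independent_finite_in_fin_dim:
  assumes "fin_dim scale V" "independent B" "B \<subseteq> V"
  shows "finite B"
  using assms independent_span_bound by (auto simp: fin_dim_def)

lemma independent_card_le_dim_fin_dim:
  assumes "fin_dim scale V" "independent B" "B \<subseteq> V"
  shows "card B \<le> dim V"
proof -
  obtain C where "C \<subseteq> V" "independent C" "V \<subseteq> span C" "card C = dim V"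
    using basis_exists by blast
  moreover have "finite C"
    using independent_finite_in_fin_dim assms(1) calculation by blast
  ultimately show ?thesis
    using independent_span_bound[of C B] assms by auto
qed

lemma fin_dim_subset:
  assumes "fin_dim scale V" "subspace W" "W \<subseteq> V"
  shows "fin_dim scale W"
proof -
  obtain B where B: "B \<subseteq> W" "independent B" "W \<subseteq> span B" "card B = dim W"
    using basis_exists by blast
  then have "finite B"
    using independent_finite_in_fin_dim assms by blast
  moreover have "W = span B"
    using B assms(2) span_minimal by blast
  ultimately show ?thesis
    by (auto simp: fin_dim_def)
qed

lemma dim_mono_fin_dim:
  assumes "fin_dim scale V" "W \<subseteq> V"
  shows "dim W \<le> dim V"
  using basis_exists[of W] independent_card_le_dim_fin_dim[OF assms(1)] assms(2)
  by (metis subset_trans)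

text \<open>A vector of \<open>V\<close> outside \<open>W\<close> would enlarge a basis of
  \<open>W\<close> to an independent subset of \<open>V\<close> with more than \<open>dim V\<close>
  elements.\<close>

lemma fin_dim_eqI:
  assumes "fin_dim scale V" "subspace W" "W \<subseteq> V" "dim V \<le> dim W"
  shows "W = V"
proof (rule ccontr)
  assume "W \<noteq> V"
  then obtain v where v: "v \<in> V" "v \<notin> W"
    using assms(3) by auto
  obtain B where B: "B \<subseteq> W" "independent B" "W \<subseteq> span B" "card B = dim W"
    using basis_exists by blast
  then have "v \<notin> span B"
    using v assms(2) span_minimal by blast
  then have "independent (insert v B)" "v \<notin> B"
    using independent_insertI B span_base by auto
  moreover have "finite B"
    using independent_finite_in_fin_dim assms B by blast
  ultimately show False
    using independent_card_le_dim_fin_dim[OF assms(1), of "insert v B"] v B assms(3,4) by auto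
qed

text \<open>A basis \<open>B\<close> of the kernel extends to a basis \<open>C\<close> of
  \<open>V\<close>. On the span of \<open>C - B\<close> the map \<open>q\<close> is injective, and
  this span already has the same image as \<open>V\<close>.\<close>

lemma rank_nullity:
  assumes "fin_dim scale V" "Vector_Spaces.linear scale scale q"
  shows "dim V = dim (q ` V) + dim {v \<in> V. q v = 0}"
proof -
  interpret q: Vector_Spaces.linear scale scale q by fact
  interpret vsp: vector_space_pair scale scale ..
  let ?K = "{v \<in> V. q v = 0}"
  have V: "subspace V"
    using assms fin_dim_subspace by blast
  obtain B where B: "B \<subseteq> ?K" "independent B" "?K \<subseteq> span B" "card B = dim ?K"
    using basis_exists by blast
  obtain C where C: "B \<subseteq> C" "C \<subseteq> V" "independent C" "V \<subseteq> span C"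
    using maximal_independent_subset_extend[of B V] B by auto
  have fC: "finite C"
    using independent_finite_in_fin_dim assms C by blast
  have cC: "card C = dim V"
    using basis_card_eq_dim C by blast
  \<comment> \<open>The coordinates of such an \<open>x\<close> in the basis \<open>C\<close> are
    supported both in \<open>C - B\<close> and in \<open>B\<close>, hence all vanish.\<close>
  have inj: "x = 0" if "x \<in> span (C - B)" "x \<in> span B" for x
  proof -
    have "representation C x b = 0" for b
      using representation_extend[OF C(3) that(1) Diff_subset]
        representation_extend[OF C(3) that(2) C(1)] representation_ne_zero[of B x b]
        representation_ne_zero[of "C - B" x b]
      by auto
    moreover have "x \<in> span C"
      using that C(1) span_mono by blast
    ultimately show ?thesis
      using sum_nonzero_representation_eq[OF C(3), of x] by simp
  qed
  have inj': "inj_on q (span (C - B))"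
    unfolding q.inj_on_iff_eq_0[OF subspace_span]
  proof safe
    fix x assume x: "x \<in> span (C - B)" "q x = 0"
    then have "x \<in> V"
      using C V span_minimal[of "C - B" V] by blast
    then show "x = 0"
      using x B inj by auto
  qed
  have "q ` V = q ` span (C - B)"
  proof (intro equalityI subsetI; elim imageE)
    fix y v assume v: "y = q v" "v \<in> V"
    moreover have "C - B \<union> B = C"
      using C(1) by blast
    ultimately have "v \<in> span (C - B \<union> B)"
      using C(4) by auto
    then obtain a b where "v = a + b" "a \<in> span (C - B)" "b \<in> span B"
      unfolding span_Un by blast
    moreover have "q b = 0"
    proof -
      have "subspace {v \<in> V. q v = 0}"
        using V unfolding subspace_def by (auto simp: q.add q.scale q.zero)
      then show ?thesis
        using B(1) calculation(3) span_minimal by blast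
    qed
    ultimately show "y \<in> q ` span (C - B)"
      using v by (auto simp: q.add)
  next
    fix y v assume "y = q v" "v \<in> span (C - B)"
    then show "y \<in> q ` V"
      using C V span_minimal[of "C - B" V] by blast
  qed
  then have "q ` V = span (q ` (C - B))"
    by (simp add: q.span_image)
  moreover have "independent (q ` (C - B))"
    using q.independent_injective_image inj' independent_mono[OF C(3)] by simp
  ultimately have "dim (q ` V) = card (q ` (C - B))"
    using dim_span_eq_card_independent by simp
  also have "\<dots> = card (C - B)"
    using inj' by (meson card_image inj_on_subset span_superset)
  also have "\<dots> = dim V - dim ?K"
    using B(4) C(1) cC fC by (simp add: card_Diff_subset finite_subset)
  finally show ?thesis
    using dim_mono_fin_dim[OF assms(1), of ?K] by auto
qed

text \<open>Rank-nullity reduces the equality to the dimensions of the kernels of \<open>q\<close>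
  on \<open>V\<close> and on \<open>W\<close>. The last hypothesis puts the kernel on
  \<open>W\<close> inside the one on \<open>V\<close>, so equal dimensions force them to
  coincide.\<close>

lemma dim_eq_iff_kernel_subset:
  assumes "fin_dim scale V" "fin_dim scale W" "Vector_Spaces.linear scale scale q" "q ` V = q ` W"
    and "{w \<in> W. q w = 0} \<subseteq> V"
  shows "dim V = dim W \<longleftrightarrow> {v \<in> V. q v = 0} \<subseteq> W"
proof -
  interpret q: Vector_Spaces.linear scale scale q by fact
  let ?KV = "{v \<in> V. q v = 0}" and ?KW = "{w \<in> W. q w = 0}"
  have sub: "subspace {u \<in> U. q u = 0}" if "fin_dim scale U" for U
    using fin_dim_subspace[OF that] unfolding subspace_def by (simp add: q.add q.scale)
  have "dim V = dim W \<longleftrightarrow> dim ?KV = dim ?KW"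
    unfolding rank_nullity[OF assms(1,3)] rank_nullity[OF assms(2,3)] assms(4) by simp
  also have "\<dots> \<longleftrightarrow> ?KV \<subseteq> W"
  proof
    assume "dim ?KV = dim ?KW"
    then have "?KW = ?KV"
      using assms(5)
      by (intro fin_dim_eqI[OF fin_dim_subset[OF assms(1) sub[OF assms(1)]] sub[OF assms(2)]]) auto
    then show "?KV \<subseteq> W"
      by auto
  next
    assume "?KV \<subseteq> W"
    then have "?KV = ?KW"
      using assms(5) by blast
    then show "dim ?KV = dim ?KW"
      by simp
  qed
  finally show ?thesis .
qed

end

section \<open>Linear maps controlled only on a subspace\<close>

lemma linmap_zero: "linmap s V t W f \<Longrightarrow> 0 \<in> V \<Longrightarrow> f 0 = 0"
  unfolding linmap_def by (metis add_cancel_right_right)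

lemma linmap_sum:
  assumes "linmap s V t W f" "0 \<in> V" "\<And>u v. u \<in> V \<Longrightarrow> v \<in> V \<Longrightarrow> u + v \<in> V"
    and "\<And>i. i \<in> K \<Longrightarrow> h i \<in> V"
  shows "f (\<Sum>i\<in>K. h i) = (\<Sum>i\<in>K. f (h i)) \<and> (\<Sum>i\<in>K. h i) \<in> V"
  using assms(4)
proof (induction K rule: infinite_finite_induct)
  case (insert k K)
  then show ?case
    using assms(1-3) by (simp add: linmap_def)
qed (use assms linmap_zero in auto)

lemma linmap_diff:
  assumes "linmap s V t W f" "u \<in> V" "v \<in> V" "u - v \<in> V"
  shows "f (u - v) = f u - f v"
  using assms unfolding linmap_def by (metis add_diff_cancel diff_add_cancel)

text \<open>Only the values of \<open>f\<close> on \<open>V\<close> are controlled by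
  \<open>linmap\<close>. Extending linearly from a basis of \<open>V\<close> yields a globally
  linear map, to which the theory of \<open>Vector_Spaces.linear\<close> applies.\<close>

lemma linmap_extend:
  assumes "vector_space s" "vector_space t" "linmap s V t W f" "module.subspace s V"
  obtains g where "Vector_Spaces.linear s t g" "\<And>v. v \<in> V \<Longrightarrow> g v = f v"
proof -
  interpret vs: vector_space s by fact
  interpret vt: vector_space t by fact
  interpret vsp: vector_space_pair s t ..
  obtain B where B: "B \<subseteq> V" "vs.independent B" "V \<subseteq> vs.span B"
    by (rule vs.basis_exists)
  define g where "g = vsp.construct B f"
  have lin: "Vector_Spaces.linear s t g"
    unfolding g_def by (rule vsp.linear_construct[OF B(2)])
  then interpret g: Vector_Spaces.linear s t g .
  have "v \<in> V \<and> g v = f v" if "v \<in> vs.span B" for v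
    using that
  proof (induction rule: vs.span_induct_alt)
    case base
    then show ?case
      using vs.subspace_0[OF assms(4)] linmap_zero[OF assms(3)] g.zero by simp
  next
    case (step c x y)
    have x: "g x = f x" "x \<in> V"
      unfolding g_def using vsp.construct_basis[OF B(2) step(1)] B(1) step(1) by blast+
    have "s c x \<in> V" "s c x + y \<in> V"
      using vs.subspace_add[OF assms(4)] vs.subspace_scale[OF assms(4)] step(2) x by blast+
    then show ?case
      using step(2) x assms(3) unfolding linmap_def by (simp add: g.add g.scale)
  qed
  then show ?thesis
    using that[OF lin] B(3) by blast
qed

lemma fin_dim_image:
  assumes "vector_space s" "vector_space t" "linmap s V t W f" "fin_dim s V"
  shows "fin_dim t (f ` V)"
proof -
  interpret vs: vector_space s by fact
  interpret vt: vector_space t by fact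
  obtain g where g: "Vector_Spaces.linear s t g" "\<And>v. v \<in> V \<Longrightarrow> g v = f v"
    using linmap_extend[OF assms(1-3)] vs.fin_dim_subspace[OF assms(4)] by blast
  interpret g: Vector_Spaces.linear s t g by fact
  obtain B where "finite B" "V = vs.span B"
    using assms(4) by (auto simp: fin_dim_def)
  then have "f ` V = vt.span (g ` B)" "finite (g ` B)"
    using g.span_image g(2) by (auto simp: image_iff) 
  then show ?thesis
    unfolding fin_dim_def by blast
qed

text \<open>An injective linear map carries a basis of \<open>V\<close> to an independent set
  spanning the image, so the image has the dimension of \<open>V\<close>; a subspace of
  \<open>W\<close> of full dimension is all of \<open>W\<close>.\<close>

lemma dim_inj_linmap:
  assumes "vector_space s" "vector_space t" "linmap s V t W f" "module.subspace s V"
    and "fin_dim t W" "inj_on f V"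
  shows "vector_space.dim s V \<le> vector_space.dim t W"
    and "vector_space.dim s V = vector_space.dim t W \<Longrightarrow> f ` V = W"
proof -
  interpret vs: vector_space s by fact
  interpret vt: vector_space t by fact
  obtain g where g: "Vector_Spaces.linear s t g" "\<And>v. v \<in> V \<Longrightarrow> g v = f v"
    using linmap_extend[OF assms(1-4)] by blast
  interpret g: Vector_Spaces.linear s t g by fact
  obtain B where B: "B \<subseteq> V" "vs.independent B" "V \<subseteq> vs.span B" "card B = vs.dim V"
    by (rule vs.basis_exists)
  have VB: "V = vs.span B"
    using B assms(4) vs.span_minimal by blast
  have inj: "inj_on g (vs.span B)"
    using assms(6) g(2) VB by (simp add: inj_on_def)
  have im: "g ` V = f ` V"
    using g(2) by (simp cong: image_cong)
  have "vt.independent (g ` B)"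
    using g.independent_injective_image B(2) inj by blast
  moreover have "f ` V = vt.span (g ` B)"
    using im VB g.span_image by simp
  ultimately have d: "vt.dim (f ` V) = vs.dim V"
    using vt.dim_span_eq_card_independent B(4) inj
    by (metis card_image inj_on_subset vs.span_superset)
  have sub: "f ` V \<subseteq> W" "vt.subspace (f ` V)"
    using assms(3) im g.subspace_image[OF assms(4)] by (auto simp: linmap_def)
  show "vs.dim V \<le> vt.dim W"
    using vt.dim_mono_fin_dim[OF assms(5) sub(1)] d by simp
  show "f ` V = W" if "vs.dim V = vt.dim W"
    using vt.fin_dim_eqI[OF assms(5) sub(2,1)] d that by simp
qed

section \<open>Sequence spaces with coordinatewise scalar multiplication\<close>

lemma vector_space_fun:
  assumes "\<And>i. vector_space (s i)"
  shows "vector_space (\<lambda>c v i. s i c (v i))"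
proof -
  have "s i a (x + y) = s i a x + s i a y" "s i (a + b) x = s i a x + s i b x"
    "s i a (s i b x) = s i (a * b) x" "s i 1 x = x" for i a b x y
    using assms[of i] unfolding vector_space_def by auto
  then show ?thesis
    unfolding vector_space_def by (auto simp: fun_eq_iff plus_fun_def)
qed

text \<open>Induction on \<open>n\<close>: the space is the sum of a copy of \<open>V n\<close> in
  coordinate \<open>n\<close> and the space for the coordinates below, so two finite spanning sets
  are joined.\<close>

lemma fin_dim_fun:
  fixes V :: "nat \<Rightarrow> 'v::ab_group_add set"
  assumes "\<And>i. vector_space (s i)" "\<And>i. i < n \<Longrightarrow> fin_dim (s i) (V i)"
  shows "fin_dim (\<lambda>c v i. s i c (v i)) {v. (\<forall>i<n. v i \<in> V i) \<and> (\<forall>i\<ge>n. v i = 0)}"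
    (is "fin_dim ?S (?U n)")
  using assms(2)
proof (induction n)
  case 0
  interpret vector_space ?S
    using vector_space_fun assms(1) .
  have "?U 0 = {0}"
    by (auto simp: fun_eq_iff)
  then show ?case
    unfolding fin_dim_def by (intro exI[of _ "{}"]) auto
next
  case (Suc n)
  interpret vector_space ?S
    using vector_space_fun assms(1) .
  interpret si: vector_space "s i" for i
    using assms(1) .
  let ?e = "\<lambda>v i. if i = n then v else 0"
  have "linmap (s n) (V n) ?S UNIV ?e"
    by (auto simp: linmap_def fun_eq_iff)
  then have "fin_dim ?S (?e ` V n)"
    using fin_dim_image[OF si.vector_space_axioms vector_space_axioms] Suc by blast
  moreover have "fin_dim ?S (?U n)"
    using Suc by simp
  ultimately obtain B C where B: "finite B" "?e ` V n = span B" and C: "finite C" "?U n = span C"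
    by (auto simp: fin_dim_def)
  have "?U (Suc n) = {x + y |x y. x \<in> span B \<and> y \<in> span C}"
  proof (intro equalityI subsetI)
    fix v assume v: "v \<in> ?U (Suc n)"
    have "v = ?e (v n) + (\<lambda>i. if i = n then 0 else v i)"
      by (auto simp: fun_eq_iff)
    moreover have "?e (v n) \<in> ?e ` V n" "(\<lambda>i. if i = n then 0 else v i) \<in> ?U n"
      using v by auto
    ultimately show "v \<in> {x + y |x y. x \<in> span B \<and> y \<in> span C}"
      unfolding B(2)[symmetric] C(2)[symmetric] by blast
  next
    fix v assume "v \<in> {x + y |x y. x \<in> span B \<and> y \<in> span C}"
    then obtain w y where "w \<in> V n" "y \<in> ?U n" "v = ?e w + y"
      unfolding B(2)[symmetric] C(2)[symmetric] by auto
    then show "v \<in> ?U (Suc n)"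
      by (auto simp: less_Suc_eq)
  qed
  then have "?U (Suc n) = span (B \<union> C)"
    by (simp add: span_Un)
  then show ?case
    unfolding fin_dim_def using B(1) C(1) by blast
qed


section \<open>Morphisms of modules\<close>

lemma khom_simps [simp]: "0 \<in> khom x y" "x \<le> y \<Longrightarrow> \<alpha> \<in> khom x y"
  by (auto simp: khom_def)

section \<open>Calculation rules inside a single module\<close>

context
  fixes M :: "('k::field, 'v::ab_group_add, 's::order) kmod"
  assumes M: "is_kmod M"
begin

lemma kmod_vector_space: "vector_space (scl M)"
  using M by (simp add: is_kmod_def)

interpretation vector_space "scl M"
  by (rule kmod_vector_space)

lemma kmod_fin_dim: "fin_dim (scl M) (obj M x)"
  using M by (simp add: is_kmod_def fin_dim_def)

lemma kmod_subspace: "subspace (obj M x)"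
  using kmod_fin_dim fin_dim_subspace by blast

lemma kmod_zero [simp]: "0 \<in> obj M x"
  using subspace_0 kmod_subspace by blast

lemma kmod_add: "u \<in> obj M x \<Longrightarrow> v \<in> obj M x \<Longrightarrow> u + v \<in> obj M x"
  using subspace_add kmod_subspace by blast

lemma kmod_sum: "(\<And>i. i \<in> K \<Longrightarrow> h i \<in> obj M x) \<Longrightarrow> (\<Sum>i\<in>K. h i) \<in> obj M x"
  using subspace_sum kmod_subspace by blast

lemma kmod_diff: "u \<in> obj M x \<Longrightarrow> v \<in> obj M x \<Longrightarrow> u - v \<in> obj M x"
  using subspace_diff kmod_subspace by blast

lemma kmod_scl: "v \<in> obj M x \<Longrightarrow> scl M c v \<in> obj M x"
  using subspace_scale kmod_subspace by blast

lemma kmod_scl_add: "scl M c (u + v) = scl M c u + scl M c v"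
  by (rule scale_right_distrib)

lemma kmod_scl_diff: "scl M c (u - v) = scl M c u - scl M c v"
  by (rule scale_right_diff_distrib)

lemma kmod_scl_zero: "scl M c 0 = 0" "scl M 0 v = 0"
  by simp_all

lemma kmod_scl_sum: "scl M c (\<Sum>i\<in>K. h i) = (\<Sum>i\<in>K. scl M c (h i))"
  by (rule scale_sum_right)

lemma kmod_linmap:
  "\<alpha> \<in> khom x y \<Longrightarrow> linmap (scl M) (obj M x) (scl M) (obj M y) (arr M x y \<alpha>)"
  using M by (simp add: is_kmod_def)

lemma kmod_arr: "\<alpha> \<in> khom x y \<Longrightarrow> v \<in> obj M x \<Longrightarrow> arr M x y \<alpha> v \<in> obj M y"
  using kmod_linmap by (simp add: linmap_def)

lemma kmod_arr_zero: "\<alpha> \<in> khom x y \<Longrightarrow> arr M x y \<alpha> 0 = 0"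
  using kmod_linmap linmap_zero kmod_zero by blast

lemma kmod_arr_sum:
  assumes "\<alpha> \<in> khom x y" "\<And>i. i \<in> K \<Longrightarrow> h i \<in> obj M x"
  shows "arr M x y \<alpha> (\<Sum>i\<in>K. h i) = (\<Sum>i\<in>K. arr M x y \<alpha> (h i))"
  using linmap_sum[OF kmod_linmap[OF assms(1)], where h = h and K = K] assms(2) kmod_add kmod_zero
  by blast

lemma kmod_arr_add:
  "\<alpha> \<in> khom x y \<Longrightarrow> u \<in> obj M x \<Longrightarrow> v \<in> obj M x \<Longrightarrow>
    arr M x y \<alpha> (u + v) = arr M x y \<alpha> u + arr M x y \<alpha> v"
  using kmod_linmap by (simp add: linmap_def)

lemma kmod_arr_diff:
  "\<alpha> \<in> khom x y \<Longrightarrow> u \<in> obj M x \<Longrightarrow> v \<in> obj M x \<Longrightarrow>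
    arr M x y \<alpha> (u - v) = arr M x y \<alpha> u - arr M x y \<alpha> v"
  using kmod_linmap linmap_diff kmod_diff by blast

lemma kmod_arr_scalar:
  "\<alpha> \<in> khom x y \<Longrightarrow> v \<in> obj M x \<Longrightarrow> arr M x y (c * \<alpha>) v = scl M c (arr M x y \<alpha> v)"
  using M by (simp add: is_kmod_def)

lemma kmod_arr_scalar_zero: "v \<in> obj M x \<Longrightarrow> arr M x y 0 v = 0"
  using kmod_arr_scalar[of 0 x y v 0] by simp

lemma kmod_arr_eq_scl: "x \<le> y \<Longrightarrow> v \<in> obj M x \<Longrightarrow> arr M x y \<alpha> v = scl M \<alpha> (arr M x y 1 v)"
  using kmod_arr_scalar[of 1 x y v \<alpha>] by simp

text \<open>The record update keeps \<open>scl\<close> and \<open>arr\<close>, so the module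
  equations are inherited from \<open>M\<close>; finite dimension passes to subspaces.\<close>

lemma is_kmod_submodule:
  assumes "\<And>x. W x \<subseteq> obj M x" "\<And>x. 0 \<in> W x"
    and "\<And>x u v. u \<in> W x \<Longrightarrow> v \<in> W x \<Longrightarrow> u + v \<in> W x"
    and "\<And>x c v. v \<in> W x \<Longrightarrow> scl M c v \<in> W x"
    and "\<And>x y \<alpha> v. \<alpha> \<in> khom x y \<Longrightarrow> v \<in> W x \<Longrightarrow> arr M x y \<alpha> v \<in> W y"
  shows "is_kmod (M\<lparr>obj := W\<rparr>)"
proof -
  have W: "v \<in> obj M x" if "v \<in> W x" for x v
    using that assms(1) by auto
  have "subspace (W x)" for x
    using assms(2-4) by (intro subspaceI)
  then have "\<exists>B. finite B \<and> W x = span B" for x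
    using fin_dim_subset[OF kmod_fin_dim _ assms(1)] by (auto simp: fin_dim_def)
  then show ?thesis
    using M assms(5) unfolding is_kmod_def linmap_def by (simp add: W)
qed

end

text \<open>Shares its clauses with \<open>kmod_iso\<close>, apart from bijectivity. Values of
  \<open>f x\<close> outside \<open>obj M x\<close> are unconstrained.\<close>

definition kmod_hom ::
  "('k::field, 'v::ab_group_add, 's::order) kmod \<Rightarrow> ('k, 'w::ab_group_add, 's) kmod \<Rightarrow>
    ('s \<Rightarrow> 'v \<Rightarrow> 'w) \<Rightarrow> bool" where
  "kmod_hom M N f \<longleftrightarrow>
     (\<forall>x. linmap (scl M) (obj M x) (scl N) (obj N x) (f x)) \<and>
     (\<forall>x y. \<forall>\<alpha>\<in>khom x y. \<forall>v\<in>obj M x. f y (arr M x y \<alpha> v) = arr N x y \<alpha> (f x v))"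

lemma kmod_hom_linmap: "kmod_hom M N f \<Longrightarrow> linmap (scl M) (obj M x) (scl N) (obj N x) (f x)"
  by (simp add: kmod_hom_def)

lemma kmod_hom_in: "kmod_hom M N f \<Longrightarrow> v \<in> obj M x \<Longrightarrow> f x v \<in> obj N x"
  by (simp add: kmod_hom_def linmap_def)

lemma kmod_hom_add:
  "kmod_hom M N f \<Longrightarrow> u \<in> obj M x \<Longrightarrow> v \<in> obj M x \<Longrightarrow> f x (u + v) = f x u + f x v"
  by (simp add: kmod_hom_def linmap_def)

lemma kmod_hom_scl:
  "kmod_hom M N f \<Longrightarrow> v \<in> obj M x \<Longrightarrow> f x (scl M c v) = scl N c (f x v)"
  by (simp add: kmod_hom_def linmap_def)

lemma kmod_hom_arr:
  "kmod_hom M N f \<Longrightarrow> \<alpha> \<in> khom x y \<Longrightarrow> v \<in> obj M x \<Longrightarrow>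
    f y (arr M x y \<alpha> v) = arr N x y \<alpha> (f x v)"
  by (simp add: kmod_hom_def)

lemma kmod_hom_zero: "kmod_hom M N f \<Longrightarrow> 0 \<in> obj M x \<Longrightarrow> f x 0 = 0"
  using kmod_hom_linmap linmap_zero by blast

lemma kmod_hom_diff:
  "kmod_hom M N f \<Longrightarrow> is_kmod M \<Longrightarrow> u \<in> obj M x \<Longrightarrow> v \<in> obj M x \<Longrightarrow>
    f x (u - v) = f x u - f x v"
  using kmod_hom_linmap linmap_diff kmod_diff by blast

lemma kmod_hom_sum:
  assumes "kmod_hom M N f" "is_kmod M" "\<And>i. i \<in> K \<Longrightarrow> h i \<in> obj M x"
  shows "f x (\<Sum>i\<in>K. h i) = (\<Sum>i\<in>K. f x (h i))"
  using linmap_sum[OF kmod_hom_linmap[OF assms(1)], where h = h and K = K]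
    assms(2,3) kmod_add[OF assms(2)] kmod_zero by blast

lemma kmod_hom_comp:
  assumes "kmod_hom M N f" "kmod_hom N L g"
  shows "kmod_hom M L (\<lambda>x v. g x (f x v))"
  using assms unfolding kmod_hom_def linmap_def by simp

text \<open>The linearization has one generator for each relation \<open>x \<le> y\<close>: a
  morphism is a scalar multiple of it, or 0 if the relation fails. So naturality is tested at the
  scalar 1 only.\<close>

lemma kmod_homI:
  fixes M :: "('k::field, 'v::ab_group_add, 's::order) kmod"
    and N :: "('k, 'w::ab_group_add, 's) kmod"
  assumes "is_kmod M" "is_kmod N"
    and "\<And>x. linmap (scl M) (obj M x) (scl N) (obj N x) (f x)"
    and "\<And>x y v. x \<le> y \<Longrightarrow> v \<in> obj M x \<Longrightarrow> f y (arr M x y 1 v) = arr N x y 1 (f x v)"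
  shows "kmod_hom M N f"
  unfolding kmod_hom_def
proof (intro conjI allI ballI)
  fix x y v and \<alpha> :: 'k assume \<alpha>: "\<alpha> \<in> khom x y" and v: "v \<in> obj M x"
  have fv: "f x v \<in> obj N x" and f0: "f y 0 = 0"
    using assms(3) v linmap_zero[OF assms(3)] kmod_zero[OF assms(1)] by (auto simp: linmap_def)
  show "f y (arr M x y \<alpha> v) = arr N x y \<alpha> (f x v)"
  proof (cases "x \<le> y")
    case True
    then have "arr M x y 1 v \<in> obj M y"
      using kmod_arr[OF assms(1)] v by simp
    then show ?thesis
      using kmod_arr_eq_scl[OF assms(1) True v, of \<alpha>] kmod_arr_eq_scl[OF assms(2) True fv, of \<alpha>]
        assms(3)[of y] assms(4)[OF True v] by (simp add: linmap_def)
  next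
    case False
    then have "\<alpha> = 0"
      using \<alpha> by (simp add: khom_def)
    then show ?thesis
      using kmod_arr_scalar_zero[OF assms(1) v] kmod_arr_scalar_zero[OF assms(2) fv] f0 by simp
  qed
qed (rule assms(3))

section \<open>Isomorphisms and their inverses\<close>

lemma kmod_iso_iff:
  "kmod_iso M N \<longleftrightarrow> (\<exists>f. kmod_hom M N f \<and> (\<forall>x. bij_betw (f x) (obj M x) (obj N x)))"
  unfolding kmod_iso_def kmod_hom_def by (rule iff_exI) auto

lemma kmod_isoI:
  assumes "kmod_hom M N f" "kmod_hom N M g"
    and "\<And>x v. v \<in> obj M x \<Longrightarrow> g x (f x v) = v" "\<And>x w. w \<in> obj N x \<Longrightarrow> f x (g x w) = w"
  shows "kmod_iso M N"
proof -
  have "bij_betw (f x) (obj M x) (obj N x)" for x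
    using assms(3,4) kmod_hom_in[OF assms(1)] kmod_hom_in[OF assms(2)]
    by (intro bij_betw_byWitness[where f' = "g x"]) auto
  then show ?thesis
    using assms(1) unfolding kmod_iso_iff by blast
qed

text \<open>The inverse of a bijective homomorphism is again linear and natural: by injectivity of
  \<open>f x\<close>, each equation for \<open>g\<close> follows from the corresponding equation for
  \<open>f\<close>.\<close>

lemma kmod_isoE:
  fixes M :: "('k::field, 'v::ab_group_add, 's::order) kmod"
    and N :: "('k, 'w::ab_group_add, 's) kmod"
  assumes "kmod_iso M N" "is_kmod M"
  obtains f g where "kmod_hom M N f" "kmod_hom N M g"
    "\<And>x v. v \<in> obj M x \<Longrightarrow> g x (f x v) = v" "\<And>x w. w \<in> obj N x \<Longrightarrow> f x (g x w) = w"
proof -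
  obtain f where f: "kmod_hom M N f" "\<And>x. bij_betw (f x) (obj M x) (obj N x)"
    using assms(1) unfolding kmod_iso_iff by blast
  define g where "g = (\<lambda>x. inv_into (obj M x) (f x))"
  have g: "g x w \<in> obj M x" "f x (g x w) = w" if "w \<in> obj N x" for x w
    using f(2)[of x] that unfolding g_def bij_betw_def
    by (auto intro: inv_into_into f_inv_into_f)
  have gf: "g x (f x v) = v" if "v \<in> obj M x" for x v
    using f(2)[of x] that unfolding g_def bij_betw_def by simp
  have g_eq: "g x w = v" if "w = f x v" "v \<in> obj M x" for x v w
    using gf that by simp
  have "kmod_hom N M g"
    unfolding kmod_hom_def linmap_def
  proof (intro conjI allI ballI g(1))
    fix x v w assume "v \<in> obj N x" "w \<in> obj N x"
    then show "g x (v + w) = g x v + g x w"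
      using g kmod_add[OF assms(2)] by (intro g_eq) (simp_all add: kmod_hom_add[OF f(1)])
  next
    fix x c v assume "v \<in> obj N x"
    then show "g x (scl N c v) = scl M c (g x v)"
      using g kmod_scl[OF assms(2)] by (intro g_eq) (simp_all add: kmod_hom_scl[OF f(1)])
  next
    fix x y v and \<alpha> :: 'k assume "\<alpha> \<in> khom x y" "v \<in> obj N x"
    then show "g y (arr N x y \<alpha> v) = arr M x y \<alpha> (g x v)"
      using g kmod_arr[OF assms(2)] by (intro g_eq) (simp_all add: kmod_hom_arr[OF f(1)])
  qed
  then show ?thesis
    using that f(1) gf g(2) by blast
qed

lemma kmod_iso_trans:
  assumes "kmod_iso M N" "kmod_iso N L"
  shows "kmod_iso M L"
proof -
  obtain f where f: "kmod_hom M N f" "\<And>x. bij_betw (f x) (obj M x) (obj N x)"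
    using assms(1) unfolding kmod_iso_iff by blast
  obtain g where g: "kmod_hom N L g" "\<And>x. bij_betw (g x) (obj N x) (obj L x)"
    using assms(2) unfolding kmod_iso_iff by blast
  have "bij_betw (\<lambda>v. g x (f x v)) (obj M x) (obj L x)" for x
    using bij_betw_trans[OF f(2) g(2), of x] by (simp add: comp_def)
  then show ?thesis
    using kmod_hom_comp[OF f(1) g(1)] unfolding kmod_iso_iff by blast
qed


section \<open>Retracts and direct sums\<close>

text \<open>No complement is mentioned, so this notion composes and restricts along
  \<open>\<zeta>\<close> directly; \<open>summand_iff_retract\<close> identifies it with being a
  direct summand.\<close>

definition retract ::
  "('k::field, 'v::ab_group_add, 's::order) kmod \<Rightarrow> ('k, 'w::ab_group_add, 's) kmod \<Rightarrow> bool" where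
  "retract A N \<longleftrightarrow>
     (\<exists>f g. kmod_hom A N f \<and> kmod_hom N A g \<and> (\<forall>x. \<forall>v\<in>obj A x. g x (f x v) = v))"

lemma retract_trans:
  assumes "retract A N" "retract N L"
  shows "retract A L"
proof -
  obtain f g where f: "kmod_hom A N f" "kmod_hom N A g" "\<And>x v. v \<in> obj A x \<Longrightarrow> g x (f x v) = v"
    using assms(1) unfolding retract_def by blast
  obtain h k where h: "kmod_hom N L h" "kmod_hom L N k" "\<And>x v. v \<in> obj N x \<Longrightarrow> k x (h x v) = v"
    using assms(2) unfolding retract_def by blast
  show ?thesis
    unfolding retract_def
    using kmod_hom_comp[OF f(1) h(1)] kmod_hom_comp[OF h(2) f(2)] f(3) h(3) kmod_hom_in[OF f(1)]
    by (intro exI[of _ "\<lambda>x v. h x (f x v)"] exI[of _ "\<lambda>x v. g x (k x v)"]) simp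
qed

lemma kmod_iso_retract:
  assumes "kmod_iso M N" "is_kmod M"
  shows "retract M N" "retract N M"
  using kmod_isoE[OF assms] unfolding retract_def by metis+

section \<open>Projections and inclusions of direct sums\<close>

lemma kmod_hom_fst: "kmod_hom (dsum2 A B) A (\<lambda>_. fst)"
  and kmod_hom_snd: "kmod_hom (dsum2 A B) B (\<lambda>_. snd)"
  by (auto simp: kmod_hom_def linmap_def dsum2_def)

lemma kmod_hom_inl:
  "is_kmod B \<Longrightarrow> kmod_hom A (dsum2 A B) (\<lambda>_ v. (v, 0))"
  by (auto simp: kmod_hom_def linmap_def dsum2_def kmod_scl_zero kmod_arr_zero)

lemma kmod_hom_proj: "i < m \<Longrightarrow> kmod_hom (dsum m N) (N i) (\<lambda>_ v. v i)"
  by (auto simp: kmod_hom_def linmap_def dsum_def)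

definition single :: "nat \<Rightarrow> 'v::zero \<Rightarrow> nat \<Rightarrow> 'v" where
  "single i v = (\<lambda>j. if j = i then v else 0)"

lemma kmod_hom_incl:
  assumes "\<And>i. is_kmod (N i)" "i < m"
  shows "kmod_hom (N i) (dsum m N) (\<lambda>_. single i)"
  using assms(2)
  by (auto simp: kmod_hom_def linmap_def dsum_def single_def fun_eq_iff
      kmod_scl_zero[OF assms(1)] kmod_zero[OF assms(1)] kmod_arr_zero[OF assms(1)])

lemma sum_single:
  assumes "\<forall>i\<ge>m. v i = 0"
  shows "(\<Sum>i<m. single i (v i)) = v"
proof
  fix j
  have "(\<Sum>i<m. single i (v i)) j = (\<Sum>i<m. if j = i then v i else 0)"
    by (induction m) (auto simp: single_def)
  then show "(\<Sum>i<m. single i (v i)) j = v j"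
    using assms by (simp add: sum.delta)
qed

lemma kmod_hom_dsum_expand:
  assumes "kmod_hom (dsum m N) M h" "\<And>i. is_kmod (N i)" "v \<in> obj (dsum m N) x"
  shows "(\<Sum>i<m. h x (single i (v i))) = h x v"
proof -
  let ?D = "obj (dsum m N) x"
  have "0 \<in> ?D" "\<And>u w. u \<in> ?D \<Longrightarrow> w \<in> ?D \<Longrightarrow> u + w \<in> ?D"
    using kmod_zero[OF assms(2)] kmod_add[OF assms(2)] by (auto simp: dsum_def)
  moreover have "single i (v i) \<in> ?D" if "i < m" for i
    using that kmod_hom_in[OF kmod_hom_incl[where N = N, OF assms(2) that]] assms(3)
    by (auto simp: dsum_def)
  ultimately have "h x (\<Sum>i<m. single i (v i)) = (\<Sum>i<m. h x (single i (v i)))"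
    by (intro linmap_sum[OF kmod_hom_linmap[OF assms(1)], THEN conjunct1]) (assumption | simp)+
  then show ?thesis
    using sum_single[of m v] assms(3) by (simp add: dsum_def)
qed

text \<open>Puts a decomposition into biproduct form: inclusions \<open>\<iota> i\<close> and
  projections \<open>\<pi> i\<close> that are orthogonal and whose composites sum to the
  identity.\<close>

lemma kmod_iso_dsumE:
  fixes M :: "('k::field, 'v::ab_group_add, 's::order) kmod"
    and N :: "nat \<Rightarrow> ('k, 'w::ab_group_add, 's) kmod"
  assumes "kmod_iso M (dsum m N)" "is_kmod M" "\<And>i. is_kmod (N i)"
  obtains \<iota> \<pi> where "\<And>i. i < m \<Longrightarrow> kmod_hom (N i) M (\<iota> i)" "\<And>i. i < m \<Longrightarrow> kmod_hom M (N i) (\<pi> i)"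
    "\<And>i j x v. i < m \<Longrightarrow> j < m \<Longrightarrow> v \<in> obj (N j) x \<Longrightarrow> \<pi> i x (\<iota> j x v) = (if i = j then v else 0)"
    "\<And>x v. v \<in> obj M x \<Longrightarrow> (\<Sum>i<m. \<iota> i x (\<pi> i x v)) = v"
proof -
  obtain f g where f: "kmod_hom M (dsum m N) f" and g: "kmod_hom (dsum m N) M g"
    and gf: "\<And>x v. v \<in> obj M x \<Longrightarrow> g x (f x v) = v"
    and fg: "\<And>x w. w \<in> obj (dsum m N) x \<Longrightarrow> f x (g x w) = w"
    using kmod_isoE[OF assms(1,2)] by metis
  show ?thesis
  proof (rule that[of "\<lambda>i x v. g x (single i v)" "\<lambda>i x v. f x v i"])
    show "kmod_hom (N i) M (\<lambda>x v. g x (single i v))" if "i < m" for i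
      using kmod_hom_comp[OF kmod_hom_incl[OF assms(3) that] g] .
    show "kmod_hom M (N i) (\<lambda>x v. f x v i)" if "i < m" for i
      using kmod_hom_comp[OF f kmod_hom_proj[OF that]] .
    show "f x (g x (single j v)) i = (if i = j then v else 0)"
      if "i < m" "j < m" "v \<in> obj (N j) x" for i j x v
      using fg[of "single j v" x] kmod_hom_in[OF kmod_hom_incl[where N = N, OF assms(3) that(2)] that(3)]
      by (simp add: single_def)
    show "(\<Sum>i<m. g x (single i (f x v i))) = v" if "v \<in> obj M x" for x v
      using kmod_hom_dsum_expand[OF g assms(3) kmod_hom_in[OF f that]] gf that by simp
  qed
qed

text \<open>The complement is the kernel \<open>K\<close> of \<open>g\<close>: a vector
  \<open>v\<close> corresponds to the pair of \<open>g x v\<close> and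
  \<open>v - f x (g x v)\<close>, as \<open>f\<close> after \<open>g\<close> is idempotent.\<close>

lemma retract_split:
  fixes A :: "('k::field, 'w::ab_group_add, 's::order) kmod"
    and N :: "('k, 'v::ab_group_add, 's) kmod"
  assumes N: "is_kmod N" and f: "kmod_hom A N f" and g: "kmod_hom N A g"
    and gf: "\<And>x v. v \<in> obj A x \<Longrightarrow> g x (f x v) = v"
  defines "K \<equiv> N\<lparr>obj := \<lambda>x. {w \<in> obj N x. g x w = 0}\<rparr>"
  shows "is_kmod K" "kmod_hom K N (\<lambda>_ v. v)" "kmod_hom N K (\<lambda>x v. v - f x (g x v))"
    "kmod_iso N (dsum2 A K)"
proof -
  note simps = kmod_hom_add[OF g] kmod_hom_add[OF f] kmod_hom_scl[OF g] kmod_hom_scl[OF f]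
    kmod_hom_arr[OF g] kmod_hom_arr[OF f] kmod_hom_in[OF g] kmod_hom_in[OF f]
    kmod_add[OF N] kmod_scl[OF N] kmod_arr[OF N] kmod_diff[OF N] kmod_hom_diff[OF g N] gf
  have g0: "g x 0 = 0" for x
    using kmod_hom_zero[OF g] kmod_zero[OF N] .
  \<comment> \<open>The axioms of a module are given for \<open>N\<close> only, so the laws at 0 in
    \<open>A\<close> are carried over along \<open>g\<close>.\<close>
  have A0: "scl A c 0 = 0" for c
    using kmod_hom_scl[OF g, of 0 undefined c] g0 kmod_zero[OF N] kmod_scl_zero[OF N] by simp
  have A1: "arr A x y \<alpha> 0 = 0" if "\<alpha> \<in> khom x y" for x y and \<alpha> :: 'k
    using kmod_hom_arr[OF g that, of 0] g0 kmod_zero[OF N] kmod_arr_zero[OF N that] by simp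
  show K: "is_kmod K"
    unfolding K_def
    by (rule is_kmod_submodule[OF N]) (simp_all add: simps g0 A0 A1 kmod_zero[OF N] Collect_mono_iff)
  show "kmod_hom K N (\<lambda>_ v. v)"
    by (simp add: kmod_hom_def linmap_def K_def)
  show r: "kmod_hom N K (\<lambda>x v. v - f x (g x v))"
    by (auto simp: kmod_hom_def linmap_def K_def simps kmod_scl_diff[OF N] kmod_arr_diff[OF N])
  show "kmod_iso N (dsum2 A K)"
  proof (rule kmod_isoI)
    show "kmod_hom N (dsum2 A K) (\<lambda>x v. (g x v, v - f x (g x v)))"
      using g r by (auto simp: kmod_hom_def linmap_def dsum2_def)
    show "kmod_hom (dsum2 A K) N (\<lambda>x (a, w). f x a + w)"
      by (auto simp: kmod_hom_def linmap_def dsum2_def K_def simps kmod_scl_add[OF N]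
          kmod_arr_add[OF N] add_ac)
  qed (auto simp: dsum2_def K_def simps)
qed

text \<open>In one direction, inclusion and projection of the first summand are composed with the
  isomorphism. In the other, \<open>retract_split\<close> gives a complement inside
  \<open>N\<close>, hence over the type that \<open>summand\<close> asks for.\<close>

lemma summand_iff_retract:
  fixes A :: "('k::field, 'w::ab_group_add, 's::order) kmod"
    and N :: "('k, 'v::ab_group_add, 's) kmod"
  assumes "is_kmod N"
  shows "summand A N \<longleftrightarrow> retract A N"
proof
  assume "summand A N"
  then obtain N' :: "('k, 'v, 's) kmod" where N': "is_kmod N'" "kmod_iso N (dsum2 A N')"
    unfolding summand_def by blast
  obtain f g where f: "kmod_hom N (dsum2 A N') f" and g: "kmod_hom (dsum2 A N') N g"
    and fg: "\<And>x w. w \<in> obj (dsum2 A N') x \<Longrightarrow> f x (g x w) = w"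
    using kmod_isoE[OF N'(2) assms] by metis
  show "retract A N"
    unfolding retract_def
    using kmod_hom_comp[OF kmod_hom_inl[OF N'(1), of A] g] kmod_hom_comp[OF f kmod_hom_fst] fg
      kmod_zero[OF N'(1)]
    by (intro exI[of _ "\<lambda>x v. g x (v, 0)"] exI[of _ "\<lambda>x v. fst (f x v)"]) (simp add: dsum2_def)
next
  assume "retract A N"
  then obtain f g where "kmod_hom A N f" "kmod_hom N A g" "\<And>x v. v \<in> obj A x \<Longrightarrow> g x (f x v) = v"
    unfolding retract_def by blast
  from retract_split[OF assms this] show "summand A N"
    unfolding summand_def by blast
qed

lemma kmod_iso_dsum2E:
  fixes M :: "('k::field, 'v::ab_group_add, 's::order) kmod"
    and A :: "('k, 'w::ab_group_add, 's) kmod" and B :: "('k, 'u::ab_group_add, 's) kmod"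
  assumes "kmod_iso M (dsum2 A B)" "is_kmod M"
  obtains f g where "kmod_hom M (dsum2 A B) f" "kmod_hom (dsum2 A B) M g"
    "\<And>x v. v \<in> obj M x \<Longrightarrow> g x (f x v) = v"
    "\<And>x a b. a \<in> obj A x \<Longrightarrow> b \<in> obj B x \<Longrightarrow> f x (g x (a, b)) = (a, b)"
proof -
  obtain f g where "kmod_hom M (dsum2 A B) f" "kmod_hom (dsum2 A B) M g"
    "\<And>x v. v \<in> obj M x \<Longrightarrow> g x (f x v) = v"
    "\<And>x w. w \<in> obj (dsum2 A B) x \<Longrightarrow> f x (g x w) = w"
    using kmod_isoE[OF assms] by metis
  then show ?thesis
    by (intro that[of f g]) (simp_all add: dsum2_def)
qed

section \<open>Rearranging direct sums and decomposing into indecomposables\<close>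

lemma kmod_iso_dsum2_swap: "kmod_iso (dsum2 A B) (dsum2 B A)"
  by (rule kmod_isoI[of _ _ "\<lambda>_ (v, w). (w, v)" "\<lambda>_ (v, w). (w, v)"])
    (auto simp: kmod_hom_def linmap_def dsum2_def)

lemma kmod_iso_dsum2_cong:
  assumes "kmod_iso A A'" "kmod_iso B B'"
  shows "kmod_iso (dsum2 A B) (dsum2 A' B')"
proof -
  obtain f where f: "kmod_hom A A' f" "\<And>x. bij_betw (f x) (obj A x) (obj A' x)"
    using assms(1) unfolding kmod_iso_iff by blast
  obtain g where g: "kmod_hom B B' g" "\<And>x. bij_betw (g x) (obj B x) (obj B' x)"
    using assms(2) unfolding kmod_iso_iff by blast
  have "kmod_hom (dsum2 A B) (dsum2 A' B') (\<lambda>x. map_prod (f x) (g x))"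
    using f(1) g(1) by (auto simp: kmod_hom_def linmap_def dsum2_def)
  moreover have "bij_betw (map_prod (f x) (g x)) (obj (dsum2 A B) x) (obj (dsum2 A' B') x)" for x
    using bij_betw_map_prod[OF f(2) g(2), of x x] by (simp add: dsum2_def)
  ultimately show ?thesis
    unfolding kmod_iso_iff by blast
qed

lemma kmod_iso_dsum_append:
  assumes "\<And>i. is_kmod (N i)" "\<And>i. is_kmod (N' i)"
  shows "kmod_iso (dsum2 (dsum m N) (dsum m' N'))
    (dsum (m + m') (\<lambda>i. if i < m then N i else N' (i - m)))"
proof (rule kmod_isoI)
  show "kmod_hom (dsum2 (dsum m N) (dsum m' N')) (dsum (m + m') (\<lambda>i. if i < m then N i else N' (i - m)))
    (\<lambda>x (v, w) i. if i < m then v i else w (i - m))"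
    by (auto simp: kmod_hom_def linmap_def dsum2_def dsum_def fun_eq_iff)
  show "kmod_hom (dsum (m + m') (\<lambda>i. if i < m then N i else N' (i - m))) (dsum2 (dsum m N) (dsum m' N'))
    (\<lambda>x u. (\<lambda>i. if i < m then u i else 0, \<lambda>i. u (i + m)))"
    by (auto simp: kmod_hom_def linmap_def dsum2_def dsum_def fun_eq_iff
        kmod_scl_zero[OF assms(1)])
      (metis add.commute add_diff_cancel_right' add_less_cancel_right not_add_less2)
qed (auto simp: dsum2_def dsum_def fun_eq_iff)

text \<open>This makes the total dimension a measure for splitting off summands. \<open>A\<close>
  embeds into \<open>M\<close> at every point, and where \<open>B\<close> has a nonzero vector
  \<open>b\<close> the embedding misses the image of \<open>(0, b)\<close>.\<close>

lemma total_dim_less: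
  fixes M :: "('k::field, 'v::ab_group_add, 's::{finite, order}) kmod"
    and A :: "('k, 'w::ab_group_add, 's) kmod" and B :: "('k, 'u::ab_group_add, 's) kmod"
  assumes "is_kmod M" "is_kmod A" "is_kmod B" "kmod_iso M (dsum2 A B)" "\<not> kmod_zero B"
  shows "(\<Sum>x\<in>UNIV. vector_space.dim (scl A) (obj A x))
    < (\<Sum>x\<in>UNIV. vector_space.dim (scl M) (obj M x))"
proof -
  obtain f g where f: "kmod_hom M (dsum2 A B) f" and g: "kmod_hom (dsum2 A B) M g"
    and gf: "\<And>x v. v \<in> obj M x \<Longrightarrow> g x (f x v) = v"
    and fg: "\<And>x a b. a \<in> obj A x \<Longrightarrow> b \<in> obj B x \<Longrightarrow> f x (g x (a, b)) = (a, b)"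
    using kmod_iso_dsum2E[OF assms(4,1)] by metis
  let ?j = "\<lambda>x v. g x (v, 0)"
  have j: "kmod_hom A M ?j"
    using kmod_hom_comp[OF kmod_hom_inl[OF assms(3)] g] .
  have inj: "inj_on (?j x) (obj A x)" for x
    using fg kmod_zero[OF assms(3)] by (intro inj_onI) (metis prod.inject)
  have sub: "module.subspace (scl A) (obj A x)" for x
    using kmod_subspace assms(2) .
  note d = dim_inj_linmap[OF kmod_vector_space[OF assms(2)] kmod_vector_space[OF assms(1)]
      kmod_hom_linmap[OF j] sub kmod_fin_dim[OF assms(1)] inj]
  obtain x b where b: "b \<in> obj B x" "b \<noteq> 0"
    using assms(5) kmod_zero[OF assms(3)] unfolding kmod_zero_def by blast
  have gb: "g x (0, b) \<in> obj M x"
    using kmod_hom_in[OF g, of "(0, b)" x] b kmod_zero[OF assms(2)] by (simp add: dsum2_def)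
  have "?j x ` obj A x \<noteq> obj M x"
  proof
    assume "?j x ` obj A x = obj M x"
    then obtain a where "a \<in> obj A x" "g x (0, b) = g x (a, 0)"
      using gb by force
    then show False
      using fg[of 0 x b] fg[of a x 0] b kmod_zero[OF assms(2)] kmod_zero[OF assms(3)] by simp
  qed
  then have "vector_space.dim (scl A) (obj A x) < vector_space.dim (scl M) (obj M x)"
    using d[of x] by linarith
  then show ?thesis
    using d(1) by (intro sum_strict_mono_ex1) auto
qed

text \<open>Strong induction on the total dimension, a finite sum because the poset is finite. A
  module that is neither zero nor indecomposable splits into two nonzero, hence smaller, parts whose
  decompositions are concatenated.\<close>

lemma exists_indecomposable_decomposition:
  fixes M :: "('k::field, 'v::ab_group_add, 's::{finite, order}) kmod"
  assumes "is_kmod M"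
  shows "\<exists>m (N :: nat \<Rightarrow> ('k, 'v, 's) kmod).
    (\<forall>i. is_kmod (N i)) \<and> (\<forall>i<m. indecomposable (N i)) \<and> kmod_iso M (dsum m N)"
  using assms
proof (induction "\<Sum>x\<in>UNIV. vector_space.dim (scl M) (obj M x)" arbitrary: M rule: less_induct)
  case less
  show ?case
  proof (cases "kmod_zero M \<or> indecomposable M")
    case True
    then show ?thesis
    proof
      assume "kmod_zero M"
      then have "kmod_iso M (dsum 0 (\<lambda>_. M))"
        using kmod_scl_zero[OF less.prems] kmod_arr_zero[OF less.prems]
        by (intro kmod_isoI[of _ _ "\<lambda>_ _. 0" "\<lambda>_ _. 0"])
          (auto simp: kmod_hom_def linmap_def kmod_zero_def dsum_def fun_eq_iff)
      then show ?thesis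
        using less.prems by (intro exI[of _ 0] exI[of _ "\<lambda>_. M"]) simp
    next
      assume "indecomposable M"
      moreover have "kmod_iso M (dsum 1 (\<lambda>_. M))"
        using kmod_scl_zero[OF less.prems]
        by (intro kmod_isoI[of _ _ "\<lambda>_. single 0" "\<lambda>_ v. v 0"])
          (auto simp: kmod_hom_def linmap_def single_def dsum_def fun_eq_iff)
      ultimately show ?thesis
        using less.prems by (intro exI[of _ 1] exI[of _ "\<lambda>_. M"]) simp
    qed
  next
    case False
    then obtain A B :: "('k, 'v, 's) kmod"
      where A: "is_kmod A" "\<not> kmod_zero A" and B: "is_kmod B" "\<not> kmod_zero B"
        and iso: "kmod_iso M (dsum2 A B)"
      using less.prems unfolding indecomposable_def by blast
    have "kmod_iso M (dsum2 B A)"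
      using kmod_iso_trans[OF iso kmod_iso_dsum2_swap] .
    then have lt: "(\<Sum>x\<in>UNIV. vector_space.dim (scl A) (obj A x))
        < (\<Sum>x\<in>UNIV. vector_space.dim (scl M) (obj M x))"
      "(\<Sum>x\<in>UNIV. vector_space.dim (scl B) (obj B x))
        < (\<Sum>x\<in>UNIV. vector_space.dim (scl M) (obj M x))"
      using total_dim_less less.prems A B iso by blast+
    obtain m and N :: "nat \<Rightarrow> ('k, 'v, 's) kmod" where N: "\<And>i. is_kmod (N i)" "\<And>i. i < m \<Longrightarrow> indecomposable (N i)"
      "kmod_iso A (dsum m N)"
      using less.hyps[OF lt(1) A(1)] by blast
    obtain m' and N' :: "nat \<Rightarrow> ('k, 'v, 's) kmod" where N': "\<And>i. is_kmod (N' i)" "\<And>i. i < m' \<Longrightarrow> indecomposable (N' i)"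
      "kmod_iso B (dsum m' N')"
      using less.hyps[OF lt(2) B(1)] by blast
    let ?N = "\<lambda>i. if i < m then N i else N' (i - m)"
    have "kmod_iso M (dsum (m + m') ?N)"
      using kmod_iso_trans[OF iso kmod_iso_trans[OF kmod_iso_dsum2_cong[OF N(3) N'(3)]
            kmod_iso_dsum_append[OF N(1) N'(1)]]] .
    moreover have "\<forall>i. is_kmod (?N i)" "\<forall>i<m + m'. indecomposable (?N i)"
      using N(1,2) N'(1,2) by auto
    ultimately show ?thesis
      by (intro exI[of _ "m + m'"] exI[of _ ?N]) simp
  qed
qed


section \<open>Interval modules\<close>

lemma interval_module_simps [simp]:
  "scl (interval_module S) = (*)"
  "obj (interval_module S) x = (if x \<in> S then UNIV else {0})"
  "arr (interval_module S) x y \<alpha> v = (if x \<in> S \<and> y \<in> S then \<alpha> * v else 0)"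
  by (simp_all add: interval_module_def)

text \<open>The preimage of an interval can be disconnected or empty, so the results below treat
  \<open>interval_module S\<close> for more general sets \<open>S\<close>.\<close>

lemma restrict_interval_module:
  "restrict_kmod \<zeta> (interval_module I) = interval_module (\<zeta> -` I)"
  by (simp add: restrict_kmod_def interval_module_def fun_eq_iff)

section \<open>Endomorphisms of interval modules, component by component\<close>

abbreviation comparable :: "'s::order set \<Rightarrow> ('s \<times> 's) set" where
  "comparable S \<equiv> {(a, b). a \<in> S \<and> b \<in> S \<and> (a \<le> b \<or> b \<le> a)}"

text \<open>Naturality along a relation between two points of \<open>S\<close> equates the scalars
  by which \<open>h\<close> acts there, and induction follows the zigzag.\<close>

lemma interval_module_end_const:
  assumes h: "kmod_hom (interval_module S) (interval_module S) h"
    and "(x, y) \<in> (comparable S)\<^sup>*"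
  shows "h y (1 :: 'k::field) = h x 1"
  using assms(2)
proof (induction rule: rtrancl_induct)
  case (step y z)
  have "h b (1 :: 'k) = h a 1" if "a \<in> S" "b \<in> S" "a \<le> b" for a b
    using kmod_hom_arr[OF h, of 1 a b 1] that by simp
  from this[of y z] this[of z y] show ?case
    using step(2,3) by auto
qed simp

lemma kmod_hom_interval_scalar:
  assumes "kmod_hom (interval_module S) N f" "x \<in> S"
  shows "f x v = scl N v (f x (1 :: 'k::field))"
  using kmod_hom_scl[OF assms(1), of 1 x v] assms(2) by simp

text \<open>
  An endomorphism of \<open>interval_module S\<close> is a scalar on each connected component of \<open>S\<close>.  If on
  every component some composite through \<open>N\<close> is nonzero, these composites can be rescaled and
  glued to the identity.
\<close>

lemma not_retract_vanish:
  fixes N :: "('k::field, 'v::ab_group_add, 's::order) kmod"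
  assumes A: "is_kmod (interval_module S :: ('k, 'k, 's) kmod)" and N: "is_kmod N"
    and "\<not> retract (interval_module S) N"
  obtains x\<^sub>0 where "x\<^sub>0 \<in> S"
    "\<And>f g. kmod_hom (interval_module S) N f \<Longrightarrow> kmod_hom N (interval_module S) g \<Longrightarrow>
      g x\<^sub>0 (f x\<^sub>0 1) = 0"
proof (rule ccontr)
  let ?A = "interval_module S :: ('k, 'k, 's) kmod"
  assume "\<not> thesis"
  then have "\<forall>x\<in>S. \<exists>p. kmod_hom ?A N (fst p) \<and> kmod_hom N ?A (snd p) \<and>
    snd p x (fst p x 1) \<noteq> 0"
    using that by fastforce
  then obtain p where p: "\<forall>x\<in>S. kmod_hom ?A N (fst (p x)) \<and> kmod_hom N ?A (snd (p x)) \<and>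
    snd (p x) x (fst (p x) x 1) \<noteq> 0"
    by (rule bchoice[THEN exE])
  define F where "F x = fst (p x)" for x
  define G where "G x = snd (p x)" for x
  have F: "kmod_hom ?A N (F x)" and G: "kmod_hom N ?A (G x)" and GF: "G x x (F x x 1) \<noteq> 0"
    if "x \<in> S" for x
    using p that by (auto simp: F_def G_def)
  \<comment> \<open>\<open>c x\<close> represents the connected component of \<open>x\<close>. The
    choice depends only on the set of points reachable from \<open>x\<close>, so all points of a
    component get the same representative.\<close>
  define c where "c x = (SOME y. (x, y) \<in> (comparable S)\<^sup>*)" for x
  have c: "(x, c x) \<in> (comparable S)\<^sup>*" for x
    unfolding c_def by (rule someI[of _ x]) simp
  have cS: "c x \<in> S" if "x \<in> S" for x
    using c[of x] that by (induction rule: rtrancl_induct) auto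
  have c_eq: "c x = c y" if "x \<in> S" "y \<in> S" "x \<le> y" for x y
  proof -
    have "(x, y) \<in> comparable S" "(y, x) \<in> comparable S"
      using that by auto
    then have "(x, z) \<in> (comparable S)\<^sup>* \<longleftrightarrow> (y, z) \<in> (comparable S)\<^sup>*" for z
      by (meson converse_rtrancl_into_rtrancl)
    then show ?thesis
      by (simp add: c_def)
  qed
  \<comment> \<open>The nonzero scalar of the chosen composite, the same on the whole component;
    dividing by it in \<open>g\<close> turns the glued composite into the identity.\<close>
  define s where "s x = G (c x) (c x) (F (c x) (c x) 1)" for x
  have s: "s x \<noteq> 0" "G (c x) x (F (c x) x 1) = s x" if "x \<in> S" for x
    using GF[OF cS[OF that]]
      interval_module_end_const[OF kmod_hom_comp[OF F G, OF cS[OF that] cS[OF that]] c[of x]]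
    by (simp_all add: s_def)
  define f where "f x v = (if x \<in> S then F (c x) x v else 0)" for x v
  define g where "g x w = (if x \<in> S then G (c x) x w / s x else 0)" for x w
  have "kmod_hom ?A N f"
  proof (rule kmod_homI[OF A N])
    show "linmap (scl ?A) (obj ?A x) (scl N) (obj N x) (f x)" for x
      using kmod_hom_linmap[OF F[OF cS], of x x] kmod_zero[OF N] kmod_scl_zero[OF N]
      by (auto simp: f_def linmap_def)
    show "f y (arr ?A x y 1 v) = arr N x y 1 (f x v)" if "x \<le> y" "v \<in> obj ?A x" for x y v
    proof (cases "x \<in> S")
      case True
      then show ?thesis
        using kmod_hom_arr[OF F[OF cS[OF True]], of 1 x y v] that c_eq[OF True, of y]
          kmod_hom_zero[OF F[OF cS[OF True]], of y]
        by (auto simp: f_def)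
    next
      case False
      then show ?thesis
        using that kmod_arr_zero[OF N, of 1 x y] kmod_hom_zero[OF F[OF cS], of y y]
        by (auto simp: f_def)
    qed
  qed
  moreover have "kmod_hom N ?A g"
  proof (rule kmod_homI[OF N A])
    show "linmap (scl N) (obj N x) (scl ?A) (obj ?A x) (g x)" for x
      using kmod_hom_linmap[OF G[OF cS], of x x]
      by (auto simp: g_def linmap_def add_divide_distrib)
    show "g y (arr N x y 1 w) = arr ?A x y 1 (g x w)" if "x \<le> y" "w \<in> obj N x" for x y w
    proof (cases "y \<in> S")
      case True
      then show ?thesis
        using kmod_hom_arr[OF G[OF cS[OF True]], of 1 x y w] that c_eq[of x y]
        by (auto simp: g_def s_def)
    qed (simp add: g_def)
  qed
  moreover have "g x (f x v) = v" if "v \<in> obj ?A x" for x v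
  proof (cases "x \<in> S")
    case True
    have "G (c x) x (F (c x) x v) = v * s x"
      using kmod_hom_interval_scalar[OF kmod_hom_comp[OF F[OF cS[OF True]] G[OF cS[OF True]]] True]
        s(2)[OF True] by simp
    then show ?thesis
      using s(1) True by (simp add: f_def g_def)
  qed (use that in \<open>simp add: f_def g_def\<close>)
  ultimately show False
    using assms(3) unfolding retract_def by blast
qed

text \<open>If \<open>n < m\<close>, padding with zeros gives square matrices with
  \<open>B * A = 1\<^sub>m m\<close>, hence also \<open>A * B = 1\<^sub>m m\<close>. But row
  \<open>n\<close> of the padded \<open>A\<close> is zero.\<close>

lemma identity_factorization_le:
  fixes a b :: "nat \<Rightarrow> nat \<Rightarrow> 'k::field"
  assumes "\<And>i j. i < m \<Longrightarrow> j < m \<Longrightarrow> (\<Sum>k<n. b i k * a k j) = (if i = j then 1 else 0)"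
  shows "m \<le> n"
proof (rule ccontr)
  assume "\<not> m \<le> n"
  then have nm: "n < m" by simp
  define B where "B = mat m m (\<lambda>(i, k). if k < n then b i k else 0)"
  define A where "A = mat m m (\<lambda>(k, j). if k < n then a k j else 0)"
  have carrier: "A \<in> carrier_mat m m" "B \<in> carrier_mat m m"
    by (simp_all add: A_def B_def)
  have "B * A = 1\<^sub>m m"
  proof (rule eq_matI)
    fix i j assume "i < dim_row (1\<^sub>m m :: 'k mat)" "j < dim_col (1\<^sub>m m :: 'k mat)"
    then have ij: "i < m" "j < m"
      by simp_all
    have "(B * A) $$ (i, j)
      = (\<Sum>k = 0..<m. (if k < n then b i k else 0) * (if k < n then a k j else 0))"
      using ij by (simp add: scalar_prod_def A_def B_def)
    also have "\<dots> = (\<Sum>k<n. b i k * a k j)"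
      using nm by (intro sum.mono_neutral_cong_right) auto
    also have "\<dots> = 1\<^sub>m m $$ (i, j)"
      using assms[OF ij] ij by simp
    finally show "(B * A) $$ (i, j) = 1\<^sub>m m $$ (i, j)" .
  qed (use carrier in simp_all)
  then have "A * B = 1\<^sub>m m"
    using mat_mult_left_right_inverse carrier by blast
  moreover have "(A * B) $$ (n, n) = 0"
    using nm by (simp add: scalar_prod_def A_def B_def)
  ultimately show False
    using nm by simp
qed


section \<open>Multiplicities\<close>

text \<open>An orthogonal system of \<open>n\<close> inclusions and projections; for modules this
  says that the \<open>n\<close>-fold sum of \<open>A\<close> is a direct summand of
  \<open>N\<close>.\<close>

definition copies ::
  "('k::field, 'v::ab_group_add, 's::order) kmod \<Rightarrow> ('k, 'w::ab_group_add, 's) kmod \<Rightarrow> nat \<Rightarrow> bool"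
  where
  "copies A N n \<longleftrightarrow>
     (\<exists>f g. (\<forall>i<n. kmod_hom A N (f i) \<and> kmod_hom N A (g i)) \<and>
       (\<forall>i<n. \<forall>j<n. \<forall>x. \<forall>v\<in>obj A x. g i x (f j x v) = (if i = j then v else 0)))"

lemma copiesI:
  assumes "\<And>i. i < n \<Longrightarrow> kmod_hom A N (f i)" "\<And>i. i < n \<Longrightarrow> kmod_hom N A (g i)"
    and "\<And>i j x v. i < n \<Longrightarrow> j < n \<Longrightarrow> v \<in> obj A x \<Longrightarrow> g i x (f j x v) = (if i = j then v else 0)"
  shows "copies A N n"
  unfolding copies_def using assms by (intro exI[of _ f] exI[of _ g]) simp

lemma copiesE:
  assumes "copies A N n"
  obtains f g where "\<And>i. i < n \<Longrightarrow> kmod_hom A N (f i)" "\<And>i. i < n \<Longrightarrow> kmod_hom N A (g i)"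
    "\<And>i j x v. i < n \<Longrightarrow> j < n \<Longrightarrow> v \<in> obj A x \<Longrightarrow> g i x (f j x v) = (if i = j then v else 0)"
proof -
  from assms obtain f g where fg: "\<forall>i<n. kmod_hom A N (f i) \<and> kmod_hom N A (g i)"
    "\<forall>i<n. \<forall>j<n. \<forall>x. \<forall>v\<in>obj A x. g i x (f j x v) = (if i = j then v else 0)"
    unfolding copies_def by (elim exE conjE)
  show ?thesis
    by (rule that[of f g]) (simp_all add: fg)
qed

lemma copies_mono:
  assumes "copies A N n" "m \<le> n"
  shows "copies A N m"
proof -
  obtain f g where fg: "\<And>i. i < n \<Longrightarrow> kmod_hom A N (f i)"
    "\<And>i. i < n \<Longrightarrow> kmod_hom N A (g i)"
    "\<And>i j x v. i < n \<Longrightarrow> j < n \<Longrightarrow> v \<in> obj A x \<Longrightarrow> g i x (f j x v) = (if i = j then v else 0)"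
    by (rule copiesE[OF assms(1)], rule that) blast+
  show ?thesis
    by (rule copiesI[of m A N f g]) (use fg assms(2) in simp_all)
qed

lemma copies_1: "copies A N (Suc 0) \<longleftrightarrow> retract A N"
proof
  assume "copies A N (Suc 0)"
  then show "retract A N"
    unfolding retract_def by (rule copiesE) (metis less_Suc0)
next
  assume "retract A N"
  then obtain f g where "kmod_hom A N f" "kmod_hom N A g" "\<forall>x. \<forall>v\<in>obj A x. g x (f x v) = v"
    unfolding retract_def by blast
  then show "copies A N (Suc 0)"
    by (intro copiesI[of _ A N "\<lambda>_. f" "\<lambda>_. g"]) simp_all
qed

text \<open>At \<open>x\<^sub>0\<close> the module \<open>N\<close> is made up of copies of
  \<open>interval_module S\<close> indexed by \<open>K\<close> and of parts \<open>N' l\<close> that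
  contribute nothing to composites. Evaluating \<open>m\<close> orthogonal copies there factors the
  identity matrix of size \<open>m\<close> through \<open>card K\<close> coordinates.\<close>

lemma copies_le_card:
  fixes N :: "('k::field, 'v::ab_group_add, 's::order) kmod"
    and N' :: "nat \<Rightarrow> ('k, 'w::ab_group_add, 's) kmod" and K :: "nat set"
  assumes N: "is_kmod N" and S: "x\<^sub>0 \<in> S" and K: "finite K"
    and \<iota>: "\<And>k. k \<in> K \<Longrightarrow> kmod_hom (interval_module S) N (\<iota> k)"
    and \<pi>: "\<And>k. k \<in> K \<Longrightarrow> kmod_hom N (interval_module S) (\<pi> k)"
    and \<iota>': "\<And>l. l \<in> L \<Longrightarrow> kmod_hom (N' l) N (\<iota>' l)"
    and \<pi>': "\<And>l. l \<in> L \<Longrightarrow> kmod_hom N (N' l) (\<pi>' l)"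
    and sum: "\<And>v. v \<in> obj N x\<^sub>0 \<Longrightarrow>
      (\<Sum>k\<in>K. \<iota> k x\<^sub>0 (\<pi> k x\<^sub>0 v)) + (\<Sum>l\<in>L. \<iota>' l x\<^sub>0 (\<pi>' l x\<^sub>0 v)) = v"
    and vanish: "\<And>l f g. l \<in> L \<Longrightarrow> kmod_hom (interval_module S) (N' l) f \<Longrightarrow>
      kmod_hom (N' l) (interval_module S) g \<Longrightarrow> g x\<^sub>0 (f x\<^sub>0 1) = 0"
    and "copies (interval_module S) N m"
  shows "m \<le> card K"
proof -
  let ?A = "interval_module S :: ('k, 'k, 's) kmod"
  obtain f g where f: "\<And>i. i < m \<Longrightarrow> kmod_hom ?A N (f i)" and g: "\<And>i. i < m \<Longrightarrow> kmod_hom N ?A (g i)"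
    and gf: "\<And>i j x v. i < m \<Longrightarrow> j < m \<Longrightarrow> v \<in> obj ?A x \<Longrightarrow>
      g i x (f j x v) = (if i = j then v else 0)"
    by (rule copiesE[OF assms(10)], rule that) blast+
  obtain h where h: "bij_betw h {..<card K} K"
    using ex_bij_betw_nat_finite[OF K] by (auto simp: atLeast0LessThan)
  have "(\<Sum>k<card K. g i x\<^sub>0 (\<iota> (h k) x\<^sub>0 1) * \<pi> (h k) x\<^sub>0 (f j x\<^sub>0 1)) = (if i = j then 1 else 0)"
    if ij: "i < m" "j < m" for i j
  proof -
    let ?v = "f j x\<^sub>0 1"
    have v: "?v \<in> obj N x\<^sub>0"
      using kmod_hom_in[OF f[OF ij(2)], of 1 x\<^sub>0] S by simp
    have inK: "\<iota> k x\<^sub>0 (\<pi> k x\<^sub>0 ?v) \<in> obj N x\<^sub>0" if "k \<in> K" for k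
      using kmod_hom_in[OF \<iota>[OF that]] kmod_hom_in[OF \<pi>[OF that] v] by blast
    have inL: "\<iota>' l x\<^sub>0 (\<pi>' l x\<^sub>0 ?v) \<in> obj N x\<^sub>0" if "l \<in> L" for l
      using kmod_hom_in[OF \<iota>'[OF that]] kmod_hom_in[OF \<pi>'[OF that] v] by blast
    have sums: "(\<Sum>k\<in>K. \<iota> k x\<^sub>0 (\<pi> k x\<^sub>0 ?v)) \<in> obj N x\<^sub>0"
      "(\<Sum>l\<in>L. \<iota>' l x\<^sub>0 (\<pi>' l x\<^sub>0 ?v)) \<in> obj N x\<^sub>0"
      by (rule kmod_sum[OF N], erule inK inL)+
    \<comment> \<open>\<open>\<iota> k\<close> followed by \<open>g i\<close> is an endomorphism of
      \<open>interval_module S\<close>, so at \<open>x\<^sub>0\<close> it multiplies the scalar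
      \<open>\<pi> k x\<^sub>0 ?v\<close> by its value at 1.\<close>
    have K_term: "g i x\<^sub>0 (\<iota> k x\<^sub>0 (\<pi> k x\<^sub>0 ?v)) = g i x\<^sub>0 (\<iota> k x\<^sub>0 1) * \<pi> k x\<^sub>0 ?v"
      if "k \<in> K" for k
      using kmod_hom_interval_scalar[OF kmod_hom_comp[OF \<iota>[OF that] g[OF ij(1)]] S, of "\<pi> k x\<^sub>0 ?v"]
      by (simp add: mult.commute)
    \<comment> \<open>The composites \<open>f j\<close> followed by \<open>\<pi>' l\<close> and
      \<open>\<iota>' l\<close> followed by \<open>g i\<close> meet in \<open>N' l\<close>, where
      \<open>vanish\<close> applies.\<close>
    have L_term: "g i x\<^sub>0 (\<iota>' l x\<^sub>0 (\<pi>' l x\<^sub>0 ?v)) = 0" if "l \<in> L" for l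
      using vanish[OF that kmod_hom_comp[OF f[OF ij(2)] \<pi>'[OF that]]
          kmod_hom_comp[OF \<iota>'[OF that] g[OF ij(1)]]] .
    have sK: "g i x\<^sub>0 (\<Sum>k\<in>K. \<iota> k x\<^sub>0 (\<pi> k x\<^sub>0 ?v)) = (\<Sum>k\<in>K. g i x\<^sub>0 (\<iota> k x\<^sub>0 (\<pi> k x\<^sub>0 ?v)))"
      by (rule kmod_hom_sum[OF g[OF ij(1)] N], erule inK)
    have sL: "g i x\<^sub>0 (\<Sum>l\<in>L. \<iota>' l x\<^sub>0 (\<pi>' l x\<^sub>0 ?v)) = (\<Sum>l\<in>L. g i x\<^sub>0 (\<iota>' l x\<^sub>0 (\<pi>' l x\<^sub>0 ?v)))"
      by (rule kmod_hom_sum[OF g[OF ij(1)] N], erule inL)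
    have "(if i = j then 1 else 0) = g i x\<^sub>0 ?v"
      using gf[OF ij, of 1 x\<^sub>0] S by simp
    also have "\<dots> = g i x\<^sub>0 (\<Sum>k\<in>K. \<iota> k x\<^sub>0 (\<pi> k x\<^sub>0 ?v)) + g i x\<^sub>0 (\<Sum>l\<in>L. \<iota>' l x\<^sub>0 (\<pi>' l x\<^sub>0 ?v))"
      by (subst sum[OF v, symmetric]) (rule kmod_hom_add[OF g[OF ij(1)] sums])
    also have "\<dots> = (\<Sum>k\<in>K. g i x\<^sub>0 (\<iota> k x\<^sub>0 1) * \<pi> k x\<^sub>0 ?v)"
      using K_term L_term by (simp add: sK sL)
    also have "\<dots> = (\<Sum>k<card K. g i x\<^sub>0 (\<iota> (h k) x\<^sub>0 1) * \<pi> (h k) x\<^sub>0 ?v)"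
      by (rule sum.reindex_bij_betw[OF h, symmetric])
    finally show ?thesis
      by simp
  qed
  then show ?thesis
    by (rule identity_factorization_le)
qed

text \<open>The \<open>n\<close> copies assemble to a retraction of \<open>N\<close> onto the
  \<open>n\<close>-fold sum, and \<open>N'\<close> is its kernel. If \<open>A\<close> were a retract
  of the kernel, it would be orthogonal to the copies already present and give \<open>n + 1\<close>
  of them.\<close>

lemma copies_split:
  fixes A :: "('k::field, 'w::ab_group_add, 's::order) kmod"
    and N :: "('k, 'v::ab_group_add, 's) kmod"
  assumes N: "is_kmod N" and A: "is_kmod A" and "copies A N n" "\<not> copies A N (Suc n)"
  obtains N' :: "('k, 'v, 's) kmod"
  where "is_kmod N'" "kmod_iso N (dsum2 (dsum n (\<lambda>_. A)) N')" "\<not> retract A N'"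
proof -
  obtain f g where f: "\<And>i. i < n \<Longrightarrow> kmod_hom A N (f i)" and g: "\<And>i. i < n \<Longrightarrow> kmod_hom N A (g i)"
    and gf: "\<And>i j x v. i < n \<Longrightarrow> j < n \<Longrightarrow> v \<in> obj A x \<Longrightarrow>
      g i x (f j x v) = (if i = j then v else 0)"
    by (rule copiesE[OF assms(3)], rule that) blast+
  let ?D = "dsum n (\<lambda>_. A)"
  let ?\<Phi> = "\<lambda>x v. \<Sum>i<n. f i x (v i)" and ?\<Psi> = "\<lambda>x w i. if i < n then g i x w else 0"
  have in_N: "f i x v \<in> obj N x" if "i < n" "v \<in> obj A x" for i x v
    using kmod_hom_in f that by blast
  have \<Phi>: "kmod_hom ?D N ?\<Phi>"
    unfolding kmod_hom_def linmap_def
  proof (intro conjI allI ballI)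
    fix x and v assume v: "v \<in> obj ?D x"
    then show "?\<Phi> x v \<in> obj N x"
      by (intro kmod_sum[OF N] in_N) (auto simp: dsum_def)
    show "?\<Phi> x (scl ?D c v) = scl N c (?\<Phi> x v)" for c
      using v unfolding kmod_scl_sum[OF N]
      by (intro sum.cong) (auto simp: dsum_def kmod_hom_scl[OF f])
    show "?\<Phi> x (v + w) = ?\<Phi> x v + ?\<Phi> x w" if "w \<in> obj ?D x" for w
      using v that unfolding sum.distrib[symmetric]
      by (intro sum.cong) (auto simp: dsum_def kmod_hom_add[OF f])
    show "?\<Phi> y (arr ?D x y \<alpha> v) = arr N x y \<alpha> (?\<Phi> x v)" if "\<alpha> \<in> khom x y" for y and \<alpha> :: 'k
    proof -
      have "arr N x y \<alpha> (?\<Phi> x v) = (\<Sum>i<n. arr N x y \<alpha> (f i x (v i)))"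
        using v by (intro kmod_arr_sum[OF N that] in_N) (auto simp: dsum_def)
      also have "\<dots> = ?\<Phi> y (arr ?D x y \<alpha> v)"
        using v that by (intro sum.cong) (auto simp: dsum_def kmod_hom_arr[OF f])
      finally show ?thesis ..
    qed
  qed
  have \<Psi>: "kmod_hom N ?D ?\<Psi>"
    by (auto simp: kmod_hom_def linmap_def dsum_def fun_eq_iff kmod_scl_zero[OF A]
        kmod_hom_in[OF g] kmod_hom_add[OF g] kmod_hom_scl[OF g] kmod_hom_arr[OF g])
  have \<Psi>\<Phi>: "?\<Psi> x (?\<Phi> x v) = v" if v: "v \<in> obj ?D x" for x v
  proof
    fix i
    have "g i x (?\<Phi> x v) = v i" if i: "i < n"
    proof -
      have "g i x (?\<Phi> x v) = (\<Sum>j<n. g i x (f j x (v j)))"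
        using v by (intro kmod_hom_sum[OF g[OF i] N] in_N) (auto simp: dsum_def)
      also have "\<dots> = (\<Sum>j<n. if i = j then v j else 0)"
        using v i by (intro sum.cong refl gf) (auto simp: dsum_def)
      finally show ?thesis
        using i by simp
    qed
    then show "?\<Psi> x (?\<Phi> x v) i = v i"
      using v by (auto simp: dsum_def)
  qed
  let ?K = "N\<lparr>obj := \<lambda>x. {w \<in> obj N x. ?\<Psi> x w = 0}\<rparr>"
  note split = retract_split[OF N \<Phi> \<Psi> \<Psi>\<Phi>]
  have "\<not> retract A ?K"
  proof
    assume "retract A ?K"
    then obtain f' g' where f': "kmod_hom A ?K f'" and g': "kmod_hom ?K A g'"
      and gf': "\<And>x v. v \<in> obj A x \<Longrightarrow> g' x (f' x v) = v"
      unfolding retract_def by blast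
    \<comment> \<open>Index \<open>n\<close> carries the additional copy. Its retraction first
      projects \<open>N\<close> to the kernel, which annihilates the first \<open>n\<close>
      copies.\<close>
    define f'' where "f'' i = (if i < n then f i else f')" for i
    define g'' where "g'' i = (if i < n then g i else (\<lambda>x w. g' x (w - ?\<Phi> x (?\<Psi> x w))))" for i
    have "kmod_hom A N (f'' i)" for i
      using f kmod_hom_comp[OF f' split(2)] by (simp add: f''_def)
    moreover have "kmod_hom N A (g'' i)" for i
      using g kmod_hom_comp[OF split(3) g'] by (simp add: g''_def)
    moreover have "g'' i x (f'' j x v) = (if i = j then v else 0)"
      if ij: "i < Suc n" "j < Suc n" and v: "v \<in> obj A x" for i j x v
    proof -
      have f'v: "f' x v \<in> obj N x" "?\<Psi> x (f' x v) = 0"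
        using kmod_hom_in[OF f' v] by auto
      have gf'v: "g i x (f' x v) = 0" if "i < n" for i
        using fun_cong[OF f'v(2), of i] that by simp
      have "?\<Phi> x (?\<Psi> x (f' x v)) = 0"
        by (intro sum.neutral) (simp add: gf'v kmod_hom_zero[OF f] kmod_zero[OF A])
      then have 1: "g' x (f' x v - ?\<Phi> x (?\<Psi> x (f' x v))) = v"
        using gf'[OF v] by simp
      have 2: "g' x (f j x v - ?\<Phi> x (?\<Psi> x (f j x v))) = 0" if "j < n"
      proof -
        have "?\<Phi> x (?\<Psi> x (f j x v)) = (\<Sum>i<n. if i = j then f j x v else 0)"
          using that v by (intro sum.cong) (auto simp: gf kmod_hom_zero[OF f] kmod_zero[OF A])
        then have "?\<Phi> x (?\<Psi> x (f j x v)) = f j x v"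
          using that by simp
        then show ?thesis
          using kmod_hom_zero[OF g' kmod_zero[OF split(1)]] by simp
      qed
      show ?thesis
      proof (cases "i < n")
        case True
        then show ?thesis
          using ij(2) v by (cases "j < n") (auto simp: f''_def g''_def gf gf'v)
      next
        case False
        then have "i = n"
          using ij by simp
        then show ?thesis
          using 1 2 ij(2) by (cases "j < n") (simp_all add: f''_def g''_def)
      qed
    qed
    ultimately have "copies A N (Suc n)"
      by (rule copiesI)
    then show False
      using assms(4) by blast
  qed
  then show ?thesis
    using that split(1,4) by blast
qed

text \<open>The summands give \<open>n\<close> orthogonal copies. For the upper bound,
  \<open>not_retract_vanish\<close> provides a point of \<open>S\<close> at which \<open>N'\<close>
  contributes nothing, and \<open>copies_le_card\<close> applies there.\<close>

lemma copies_dsum2_iff: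
  fixes N :: "('k::field, 'v::ab_group_add, 's::order) kmod"
    and N' :: "('k, 'w::ab_group_add, 's) kmod"
  assumes N: "is_kmod N" and A: "is_kmod (interval_module S :: ('k, 'k, 's) kmod)"
    and N': "is_kmod N'"
    and iso: "kmod_iso N (dsum2 (dsum n (\<lambda>_. interval_module S :: ('k, 'k, 's) kmod)) N')"
    and "\<not> retract (interval_module S) N'"
  shows "copies (interval_module S) N m \<longleftrightarrow> m \<le> n"
proof -
  let ?A = "interval_module S :: ('k, 'k, 's) kmod"
  let ?D = "dsum n (\<lambda>_. ?A)"
  obtain f g where f: "kmod_hom N (dsum2 ?D N') f" and g: "kmod_hom (dsum2 ?D N') N g"
    and gf: "\<And>x v. v \<in> obj N x \<Longrightarrow> g x (f x v) = v"
    and fg: "\<And>x a b. a \<in> obj ?D x \<Longrightarrow> b \<in> obj N' x \<Longrightarrow> f x (g x (a, b)) = (a, b)"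
    using kmod_iso_dsum2E[OF iso N] by metis
  define \<iota> where "\<iota> i x v = g x (single i v, 0)" for i x v
  define \<pi> where "\<pi> i x w = fst (f x w) i" for i x w
  have gl: "kmod_hom ?D N (\<lambda>x v. g x (v, 0))"
    using kmod_hom_comp[OF kmod_hom_inl[OF N'] g] .
  have incl: "kmod_hom ?A ?D (\<lambda>_. single i)" if "i < n" for i
    using kmod_hom_incl[of "\<lambda>_. ?A"] A that by blast
  have \<iota>: "kmod_hom ?A N (\<iota> i)" if "i < n" for i
    using kmod_hom_comp[OF incl[OF that] gl] by (simp add: \<iota>_def[abs_def])
  have \<pi>: "kmod_hom N ?A (\<pi> i)" if "i < n" for i
    using kmod_hom_comp[OF kmod_hom_comp[OF f kmod_hom_fst] kmod_hom_proj[OF that]]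
    by (simp add: \<pi>_def[abs_def])
  have g0: "kmod_hom N' N (\<lambda>x w. g x (0, w))"
  proof -
    have "kmod_hom N' (dsum2 ?D N') (\<lambda>_ w. (0, w))"
      using kmod_zero[OF A] by (auto simp: kmod_hom_def linmap_def dsum2_def dsum_def fun_eq_iff)
    then show ?thesis
      using kmod_hom_comp g by blast
  qed
  have "\<pi> i x (\<iota> j x v) = (if i = j then v else 0)" if "i < n" "j < n" "v \<in> obj ?A x" for i j x v
    using fg[OF kmod_hom_in[OF incl[OF that(2)] that(3)] kmod_zero[OF N']]
    by (simp add: \<pi>_def \<iota>_def single_def)
  with \<iota> \<pi> have copies: "copies ?A N n"
    by (rule copiesI)
  have le: "m \<le> n" if "copies ?A N m"
  proof -
    obtain x\<^sub>0 where x\<^sub>0: "x\<^sub>0 \<in> S"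
      "\<And>f g. kmod_hom ?A N' f \<Longrightarrow> kmod_hom N' ?A g \<Longrightarrow> g x\<^sub>0 (f x\<^sub>0 1) = 0"
      using not_retract_vanish[OF A N' assms(5)] by blast
    have "m \<le> card {..<n}"
    \<comment> \<open>\<open>N'\<close> is the only part outside the copies, so the index set
      \<open>L\<close> is a singleton.\<close>
    proof (rule copies_le_card[OF N x\<^sub>0(1) finite_lessThan, where L = "{0}" and N' = "\<lambda>_. N'"
          and \<iota>' = "\<lambda>_ x w. g x (0, w)" and \<pi>' = "\<lambda>_ x v. snd (f x v)"])
      fix v assume v: "v \<in> obj N x\<^sub>0"
      have fv: "fst (f x\<^sub>0 v) \<in> obj ?D x\<^sub>0" "snd (f x\<^sub>0 v) \<in> obj N' x\<^sub>0" "0 \<in> obj ?D x\<^sub>0"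
        using kmod_hom_in[OF f v] kmod_zero[OF A] by (auto simp: dsum2_def dsum_def)
      have "(\<Sum>k<n. \<iota> k x\<^sub>0 (\<pi> k x\<^sub>0 v)) = g x\<^sub>0 (fst (f x\<^sub>0 v), 0)"
        using kmod_hom_dsum_expand[OF gl A fv(1)] by (simp add: \<iota>_def \<pi>_def)
      moreover have "g x\<^sub>0 (fst (f x\<^sub>0 v), 0) + g x\<^sub>0 (0, snd (f x\<^sub>0 v)) = g x\<^sub>0 (f x\<^sub>0 v)"
        using kmod_hom_add[OF g, of "(fst (f x\<^sub>0 v), 0)" x\<^sub>0 "(0, snd (f x\<^sub>0 v))"] fv kmod_zero[OF N']
        by (simp add: dsum2_def)
      ultimately show "(\<Sum>k<n. \<iota> k x\<^sub>0 (\<pi> k x\<^sub>0 v)) + (\<Sum>l\<in>{0::nat}. g x\<^sub>0 (0, snd (f x\<^sub>0 v))) = v"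
        using gf[OF v] by simp
    next
      show "kmod_hom N N' (\<lambda>x v. snd (f x v))"
        using kmod_hom_comp[OF f kmod_hom_snd] .
    qed (use \<iota> \<pi> g0 x\<^sub>0 that in auto)
    then show ?thesis
      by simp
  qed
  show ?thesis
    using le copies_mono[OF copies] by blast
qed

text \<open>Existence is the given decomposition. For uniqueness, \<open>copies_dsum2_iff\<close>
  makes any two such decompositions of \<open>N\<close> describe the same set of copy
  numbers.\<close>

lemma bar_summand_mult_eq:
  fixes N N' :: "('k::field, 'v::ab_group_add, 's::order) kmod"
  assumes N: "is_kmod N" and A: "is_kmod (interval_module S :: ('k, 'k, 's) kmod)"
    and "is_kmod N'" "kmod_iso N (dsum2 (dsum n (\<lambda>_. interval_module S :: ('k, 'k, 's) kmod)) N')"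
    and "\<not> retract (interval_module S) N'"
  shows "bar_summand_mult N (interval_module S :: ('k, 'k, 's) kmod) = n"
  unfolding bar_summand_mult_def
proof (rule the_equality)
  show "\<exists>N' :: ('k, 'v, 's) kmod. is_kmod N' \<and>
      kmod_iso N (dsum2 (dsum n (\<lambda>_. interval_module S :: ('k, 'k, 's) kmod)) N') \<and>
      \<not> summand (interval_module S :: ('k, 'k, 's) kmod) N'"
    using assms(3-5) summand_iff_retract[OF assms(3)] by blast
next
  fix m
  assume "\<exists>N' :: ('k, 'v, 's) kmod. is_kmod N' \<and>
      kmod_iso N (dsum2 (dsum m (\<lambda>_. interval_module S :: ('k, 'k, 's) kmod)) N') \<and>
      \<not> summand (interval_module S :: ('k, 'k, 's) kmod) N'"
  then obtain N'' :: "('k, 'v, 's) kmod" where "is_kmod N''"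
    "kmod_iso N (dsum2 (dsum m (\<lambda>_. interval_module S :: ('k, 'k, 's) kmod)) N'')"
    "\<not> retract (interval_module S) N''"
    using summand_iff_retract by blast
  then have "k \<le> m \<longleftrightarrow> k \<le> n" for k
    using copies_dsum2_iff[OF N A] assms(3-5) by blast
  then show "m = n"
    by (simp add: order_eq_iff)
qed

text \<open>\<open>indecomposable\<close> speaks of summands over the type of \<open>N\<close>, so
  \<open>A\<close> is replaced by its image \<open>?A'\<close> under \<open>f\<close>. That image is
  nonzero, hence the complement \<open>?K\<close> vanishes and \<open>f\<close>, \<open>g\<close>
  are mutually inverse.\<close>

lemma indecomposable_retract_iso:
  fixes A :: "('k::field, 'w::ab_group_add, 's::order) kmod"
    and N :: "('k, 'v::ab_group_add, 's) kmod"
  assumes N: "indecomposable N" and A: "is_kmod A" and "retract A N" and "\<not> kmod_zero A"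
  shows "kmod_iso N A"
proof -
  have kN: "is_kmod N"
    using N by (simp add: indecomposable_def)
  obtain f g where f: "kmod_hom A N f" and g: "kmod_hom N A g"
    and gf: "\<And>x v. v \<in> obj A x \<Longrightarrow> g x (f x v) = v"
    using assms(3) unfolding retract_def by blast
  let ?A' = "N\<lparr>obj := \<lambda>x. f x ` obj A x\<rparr>"
  let ?K = "N\<lparr>obj := \<lambda>x. {w \<in> obj N x. f x (g x w) = 0}\<rparr>"
  have add: "u + v \<in> f x ` obj A x" if uv: "u \<in> f x ` obj A x" "v \<in> f x ` obj A x" for x u v
  proof -
    obtain a b where "u = f x a" "v = f x b" "a \<in> obj A x" "b \<in> obj A x"
      using uv by blast
    then show ?thesis
      using kmod_hom_add[OF f] kmod_add[OF A] by (intro image_eqI[of _ _ "a + b"]) simp_all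
  qed
  have scl: "scl N c v \<in> f x ` obj A x" if v: "v \<in> f x ` obj A x" for x c v
  proof -
    obtain a where "v = f x a" "a \<in> obj A x"
      using v by blast
    then show ?thesis
      using kmod_hom_scl[OF f] kmod_scl[OF A] by (intro image_eqI[of _ _ "scl A c a"]) simp_all
  qed
  have arr: "arr N x y \<alpha> v \<in> f y ` obj A y" if \<alpha>: "\<alpha> \<in> khom x y" and v: "v \<in> f x ` obj A x"
    for x y v and \<alpha> :: 'k
  proof -
    obtain a where "v = f x a" "a \<in> obj A x"
      using v by blast
    then show ?thesis
      using kmod_hom_arr[OF f \<alpha>] kmod_arr[OF A \<alpha>]
      by (intro image_eqI[of _ _ "arr A x y \<alpha> a"]) simp_all
  qed
  have zero: "0 \<in> f x ` obj A x" for x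
    using kmod_hom_zero[OF f kmod_zero[OF A]] kmod_zero[OF A] by (intro image_eqI[of _ _ 0]) simp_all
  have A': "is_kmod ?A'"
    using kmod_hom_in[OF f] zero add scl arr by (intro is_kmod_submodule[OF kN]) auto
  have i: "kmod_hom ?A' N (\<lambda>_ v. v)"
    using kmod_hom_in[OF f] by (auto simp: kmod_hom_def linmap_def)
  have p: "kmod_hom N ?A' (\<lambda>x w. f x (g x w))"
    using kmod_hom_comp[OF g f] kmod_hom_in[OF g] by (simp add: kmod_hom_def linmap_def)
  have fgf: "f x (g x v) = v" if "v \<in> obj ?A' x" for x v
    using that gf by auto
  have "kmod_zero ?A' \<or> kmod_zero ?K"
    using N A' retract_split(1,4)[OF kN i p fgf] unfolding indecomposable_def by blast
  moreover have "\<not> kmod_zero ?A'"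
  proof
    assume z: "kmod_zero ?A'"
    have "v = 0" if "v \<in> obj A x" for x v
    proof -
      have "f x v = 0"
        using z that by (auto simp: kmod_zero_def)
      then show ?thesis
        using gf[OF that] kmod_hom_zero[OF g kmod_zero[OF kN]] by metis
    qed
    then show False
      using assms(4) kmod_zero[OF A] by (auto simp: kmod_zero_def)
  qed
  ultimately have K: "kmod_zero ?K"
    by blast
  have "f x (g x w) = w" if w: "w \<in> obj N x" for x w
  proof -
    have "w - f x (g x w) \<in> obj ?K x"
      using kmod_hom_in[OF retract_split(3)[OF kN i p fgf] w] by simp
    then have "w - f x (g x w) \<in> {0}"
      using K unfolding kmod_zero_def by blast
    then show ?thesis
      by simp
  qed
  then show ?thesis
    by (intro kmod_isoI[OF g f] gf)
qed

text \<open>The uniqueness part of Krull-Schmidt for interval modules. Summands isomorphic to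
  \<open>?V\<close> give orthogonal copies; through any other indecomposable summand, all composites
  \<open>?V \<rightarrow> N l \<rightarrow> ?V\<close> vanish at a common point, so
  \<open>copies_le_card\<close> bounds the number of copies.\<close>

lemma decomposition_copies:
  fixes M :: "('k::field, 'v::ab_group_add, 's::order) kmod"
    and N :: "nat \<Rightarrow> ('k, 'w::ab_group_add, 's) kmod"
  assumes M: "is_kmod M" and I: "interval I" and N: "\<And>i. is_kmod (N i)"
    and indec: "\<And>i. i < m \<Longrightarrow> indecomposable (N i)" and iso: "kmod_iso M (dsum m N)"
  shows "copies (interval_module I :: ('k, 'k, 's) kmod) M k \<longleftrightarrow>
    k \<le> card {i. i < m \<and> kmod_iso (N i) (interval_module I :: ('k, 'k, 's) kmod)}"
proof -
  let ?V = "interval_module I :: ('k, 'k, 's) kmod"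
  let ?K = "{i. i < m \<and> kmod_iso (N i) ?V}"
  have V: "is_kmod ?V"
    using is_kmod_interval_module[OF I] .
  obtain \<iota> \<pi> where \<iota>: "\<And>i. i < m \<Longrightarrow> kmod_hom (N i) M (\<iota> i)"
    and \<pi>: "\<And>i. i < m \<Longrightarrow> kmod_hom M (N i) (\<pi> i)"
    and orth: "\<And>i j x v. i < m \<Longrightarrow> j < m \<Longrightarrow> v \<in> obj (N j) x \<Longrightarrow>
      \<pi> i x (\<iota> j x v) = (if i = j then v else 0)"
    and sum: "\<And>x v. v \<in> obj M x \<Longrightarrow> (\<Sum>i<m. \<iota> i x (\<pi> i x v)) = v"
    by (rule kmod_iso_dsumE[OF iso M N], rule that) blast+
  \<comment> \<open>\<open>P i p\<close> bundles an isomorphism with its inverse, so that one choice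
    over \<open>?K\<close> selects both.\<close>
  define P where "P i p \<longleftrightarrow> kmod_hom (N i) ?V (fst p) \<and> kmod_hom ?V (N i) (snd p) \<and>
      (\<forall>x. \<forall>v\<in>obj (N i) x. snd p x (fst p x v) = v) \<and>
      (\<forall>x. \<forall>w\<in>obj ?V x. fst p x (snd p x w) = w)" for i p
  have "\<exists>p. P i p" if "i \<in> ?K" for i
  proof -
    have iso_i: "kmod_iso (N i) ?V"
      using that by simp
    obtain a b where "kmod_hom (N i) ?V a" "kmod_hom ?V (N i) b"
      "\<And>x v. v \<in> obj (N i) x \<Longrightarrow> b x (a x v) = v" "\<And>x w. w \<in> obj ?V x \<Longrightarrow> a x (b x w) = w"
      by (rule kmod_isoE[OF iso_i N], rule that) blast+
    then have "P i (a, b)"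
      unfolding P_def by simp
    then show ?thesis ..
  qed
  then have "\<forall>i\<in>?K. \<exists>p. P i p"
    by blast
  then obtain p where p: "\<forall>i\<in>?K. P i (p i)"
    by (rule bchoice[THEN exE])
  define a where "a i = fst (p i)" for i
  define b where "b i = snd (p i)" for i
  have a: "kmod_hom (N i) ?V (a i)" and b: "kmod_hom ?V (N i) (b i)"
    and ba: "\<And>x v. v \<in> obj (N i) x \<Longrightarrow> b i x (a i x v) = v"
    and ab: "\<And>x w. w \<in> obj ?V x \<Longrightarrow> a i x (b i x w) = w" if "i \<in> ?K" for i
    using bspec[OF p that] unfolding P_def a_def b_def by blast+
  have \<iota>b: "kmod_hom ?V M (\<lambda>x v. \<iota> i x (b i x v))" if "i \<in> ?K" for i
    using kmod_hom_comp[OF b[OF that] \<iota>] that by simp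
  have a\<pi>: "kmod_hom M ?V (\<lambda>x v. a i x (\<pi> i x v))" if "i \<in> ?K" for i
    using kmod_hom_comp[OF \<pi> a[OF that]] that by simp
  obtain h where "bij_betw h {..<card ?K} ?K"
    using ex_bij_betw_nat_finite[of ?K] by (auto simp: atLeast0LessThan)
  then have h: "h i \<in> ?K" "h i = h j \<longleftrightarrow> i = j" if "i < card ?K" "j < card ?K" for i j
    using that by (auto simp: bij_betw_def inj_on_def)
  have "copies ?V M (card ?K)"
  proof (rule copiesI)
    fix i j x v assume ij: "i < card ?K" "j < card ?K" and v: "v \<in> obj ?V x"
    have hi: "h i \<in> ?K" "h i < m" and hj: "h j \<in> ?K" "h j < m"
      using h(1)[OF ij(1,1)] h(1)[OF ij(2,2)] by auto
    have "\<pi> (h i) x (\<iota> (h j) x (b (h j) x v)) = (if i = j then b (h j) x v else 0)"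
      using orth[OF hi(2) hj(2) kmod_hom_in[OF b[OF hj(1)] v]] h(2)[OF ij] by simp
    then show "a (h i) x (\<pi> (h i) x (\<iota> (h j) x (b (h j) x v))) = (if i = j then v else 0)"
      using ab[OF hj(1) v] kmod_hom_zero[OF a[OF hi(1)] kmod_zero[OF N]] by simp
  next
    show "kmod_hom ?V M (\<lambda>x v. \<iota> (h i) x (b (h i) x v))" if "i < card ?K" for i
      using \<iota>b[OF h(1)[OF that that]] .
    show "kmod_hom M ?V (\<lambda>x v. a (h i) x (\<pi> (h i) x v))" if "i < card ?K" for i
      using a\<pi>[OF h(1)[OF that that]] .
  qed
  moreover have "k \<le> card ?K" if k: "copies ?V M k"
  proof -
    obtain x\<^sub>0 where x\<^sub>0: "x\<^sub>0 \<in> I"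
      using I by (auto simp: interval_def)
    have "\<not> kmod_zero ?V"
    proof
      assume "kmod_zero ?V"
      then have "obj ?V x\<^sub>0 = {0}"
        unfolding kmod_zero_def by blast
      then have "(1 :: 'k) \<in> {0}"
        using x\<^sub>0 by (metis UNIV_I interval_module_simps(2))
      then show False
        by simp
    qed
    then have vanish: "g x\<^sub>0 (f x\<^sub>0 1) = 0"
      if l: "l \<in> {..<m} - ?K" and f: "kmod_hom ?V (N l) f" and g: "kmod_hom (N l) ?V g" for l f g
    proof -
      \<comment> \<open>This gives vanishing at a point that depends on \<open>l\<close>;
        connectedness of \<open>I\<close> carries it to the fixed point
        \<open>x\<^sub>0\<close>.\<close>
      have "\<not> retract ?V (N l)"
        using indecomposable_retract_iso[OF indec V, of l] l \<open>\<not> kmod_zero ?V\<close> by auto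
      then obtain x\<^sub>1 where x\<^sub>1: "x\<^sub>1 \<in> I" "g x\<^sub>1 (f x\<^sub>1 1) = 0"
        using not_retract_vanish[OF V N] f g by metis
      have "(x\<^sub>1, x\<^sub>0) \<in> (comparable I)\<^sup>*"
        using I x\<^sub>1 x\<^sub>0 by (simp add: interval_def poset_connected_def)
      then show ?thesis
        using interval_module_end_const[OF kmod_hom_comp[OF f g]] x\<^sub>1(2) by simp
    qed
    show ?thesis
    proof (rule copies_le_card[where K = ?K and L = "{..<m} - ?K" and N' = N
          and \<iota> = "\<lambda>i x v. \<iota> i x (b i x v)" and \<pi> = "\<lambda>i x v. a i x (\<pi> i x v)"
          and \<iota>' = \<iota> and \<pi>' = \<pi>, OF M x\<^sub>0 _ \<iota>b a\<pi>])
      show "finite ?K"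
        by simp
      show "copies ?V M k"
        by (rule k)
      show "kmod_hom (N l) M (\<iota> l)" "kmod_hom M (N l) (\<pi> l)" if "l \<in> {..<m} - ?K" for l
        using \<iota> \<pi> that by auto
      show "g x\<^sub>0 (f x\<^sub>0 1) = 0"
        if "l \<in> {..<m} - ?K" "kmod_hom ?V (N l) f" "kmod_hom (N l) ?V g" for l f g
        using vanish that .
      fix v assume v: "v \<in> obj M x\<^sub>0"
      have "(\<Sum>k\<in>?K. \<iota> k x\<^sub>0 (b k x\<^sub>0 (a k x\<^sub>0 (\<pi> k x\<^sub>0 v)))) = (\<Sum>k\<in>?K. \<iota> k x\<^sub>0 (\<pi> k x\<^sub>0 v))"
        using kmod_hom_in[OF \<pi> v] ba by (intro sum.cong) auto
      then show "(\<Sum>k\<in>?K. \<iota> k x\<^sub>0 (b k x\<^sub>0 (a k x\<^sub>0 (\<pi> k x\<^sub>0 v)))) +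
          (\<Sum>l\<in>{..<m} - ?K. \<iota> l x\<^sub>0 (\<pi> l x\<^sub>0 v)) = v"
        using sum.subset_diff[of ?K "{..<m}" "\<lambda>k. \<iota> k x\<^sub>0 (\<pi> k x\<^sub>0 v)"] sum[OF v]
        by (simp add: add.commute subset_iff)
    qed
  qed
  ultimately show ?thesis
    using copies_mono by blast
qed

text \<open>Finiteness of the poset guarantees a decomposition, and by
  \<open>decomposition_copies\<close> the count in any decomposition is the largest number of
  copies. Hence the description in \<open>summand_mult\<close> is unique.\<close>

lemma copies_iff_le_summand_mult:
  fixes M :: "('k::field, 'v::ab_group_add, 's::{finite, order}) kmod"
  assumes M: "is_kmod M" and I: "interval I"
  shows "copies (interval_module I :: ('k, 'k, 's) kmod) M k \<longleftrightarrow>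
    k \<le> summand_mult M (interval_module I :: ('k, 'k, 's) kmod)"
proof -
  let ?V = "interval_module I :: ('k, 'k, 's) kmod"
  let ?P = "\<lambda>n. \<exists>m (N :: nat \<Rightarrow> ('k, 'v, 's) kmod). (\<forall>i. is_kmod (N i)) \<and>
    (\<forall>i<m. indecomposable (N i)) \<and> kmod_iso M (dsum m N) \<and>
    n = card {i. i < m \<and> kmod_iso (N i) ?V}"
  have copies: "copies ?V M k \<longleftrightarrow> k \<le> n" if P: "?P n" for n k
  proof -
    from P obtain m and N :: "nat \<Rightarrow> ('k, 'v, 's) kmod" where "\<forall>i. is_kmod (N i)"
      "\<forall>i<m. indecomposable (N i)" "kmod_iso M (dsum m N)"
      "n = card {i. i < m \<and> kmod_iso (N i) ?V}"
      by (elim exE conjE)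
    then show ?thesis
      using decomposition_copies[OF M I, of N m k] by simp
  qed
  obtain m and N :: "nat \<Rightarrow> ('k, 'v, 's) kmod" where mN: "\<forall>i. is_kmod (N i)"
    "\<forall>i<m. indecomposable (N i)" "kmod_iso M (dsum m N)"
    using exists_indecomposable_decomposition[OF M] by (elim exE conjE)
  define n where "n = card {i. i < m \<and> kmod_iso (N i) ?V}"
  have n: "?P n"
    unfolding n_def using mN by (intro exI[of _ m] exI[of _ N] conjI refl)
  have "summand_mult M ?V = n"
    unfolding summand_mult_def
  proof (rule the_equality)
    show "?P n"
      by (rule n)
    show "n' = n" if "?P n'" for n'
      using copies[OF that] copies[OF n] by (meson order_antisym order_refl)
  qed
  then show ?thesis
    using copies[OF n] by simp
qed

text \<open>Replaces the ambient space: each \<open>obj M x\<close> is embedded by an injective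
  \<open>f x\<close>, independently of the other points, and the structure maps are conjugated by
  these embeddings.\<close>

lemma kmod_transport:
  fixes M :: "('k::field, 'v::ab_group_add, 's::order) kmod"
  assumes M: "is_kmod M" and t: "vector_space t"
    and lin: "\<And>x. linmap (scl M) (obj M x) t UNIV (f x)" and inj: "\<And>x. inj_on (f x) (obj M x)"
  defines "N \<equiv> \<lparr>scl = t, obj = \<lambda>x. f x ` obj M x,
    arr = \<lambda>x y \<alpha> u. f y (arr M x y \<alpha> (inv_into (obj M x) (f x) u))\<rparr>"
  shows "is_kmod N" "kmod_iso M N"
proof -
  have inv: "inv_into (obj M x) (f x) (f x v) = v" if "v \<in> obj M x" for x v
    using inj that by simp
  have fd: "fin_dim t (f x ` obj M x)" for x
    using fin_dim_image[OF kmod_vector_space[OF M] t lin kmod_fin_dim[OF M]] .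
  have arr_alg: "arr M x y (\<alpha> + \<beta>) v = arr M x y \<alpha> v + arr M x y \<beta> v" "arr M x x 1 v = v"
    if "\<alpha> \<in> khom x y" "\<beta> \<in> khom x y" "v \<in> obj M x" for x y v and \<alpha> \<beta> :: 'k
    using M that unfolding is_kmod_def by blast+
  have arr_comp: "arr M x z (\<beta> * \<alpha>) v = arr M y z \<beta> (arr M x y \<alpha> v)"
    if "\<alpha> \<in> khom x y" "\<beta> \<in> khom y z" "v \<in> obj M x" for x y z v and \<alpha> \<beta> :: 'k
    using M that unfolding is_kmod_def by blast
  have plus: "f x u + f x v = f x (u + v)" if "u \<in> obj M x" "v \<in> obj M x" for x u v
    using lin that by (simp add: linmap_def)
  have scl: "t c (f x v) = f x (scl M c v)" if "v \<in> obj M x" for x c v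
    using lin that by (simp add: linmap_def)
  have add_in: "u + v \<in> obj M x" if "u \<in> obj M x" "v \<in> obj M x" for x u v
    using kmod_add[OF M] that .
  show N: "is_kmod N"
    unfolding is_kmod_def
  proof (intro conjI allI ballI)
    show "vector_space (scl N)"
      using t by (simp add: N_def)
    show "\<exists>B. finite B \<and> obj N x = module.span (scl N) B" for x
      using fd[of x] by (simp add: N_def fin_dim_def)
  next
    fix x y :: 's and \<alpha> :: 'k assume \<alpha>: "\<alpha> \<in> khom x y"
    show "linmap (scl N) (obj N x) (scl N) (obj N y) (arr N x y \<alpha>)"
      using kmod_linmap[OF M \<alpha>] kmod_scl[OF M] add_in unfolding linmap_def N_def
      by (auto simp: inv plus scl)
    fix \<beta> :: 'k and u assume \<beta>: "\<beta> \<in> khom x y" and u: "u \<in> obj N x"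
    then obtain v where v: "u = f x v" "v \<in> obj M x"
      by (auto simp: N_def)
    then show "arr N x y (\<alpha> + \<beta>) u = arr N x y \<alpha> u + arr N x y \<beta> u"
      using arr_alg(1)[OF \<alpha> \<beta>] kmod_arr[OF M] \<alpha> \<beta> by (simp add: N_def inv plus)
  next
    fix x y :: 's and c u and \<alpha> :: 'k assume \<alpha>: "\<alpha> \<in> khom x y" and u: "u \<in> obj N x"
    then obtain v where "u = f x v" "v \<in> obj M x"
      by (auto simp: N_def)
    then show "arr N x y (c * \<alpha>) u = scl N c (arr N x y \<alpha> u)"
      using kmod_arr_scalar[OF M \<alpha>] kmod_arr[OF M \<alpha>] by (simp add: N_def inv scl)
  next
    fix x u assume u: "u \<in> obj N x"
    then obtain v where "u = f x v" "v \<in> obj M x"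
      by (auto simp: N_def)
    then show "arr N x x 1 u = u"
      using arr_alg(2)[of 1 x x 1] by (simp add: N_def inv)
  next
    fix x y z :: 's and u and \<alpha> \<beta> :: 'k assume \<alpha>: "\<alpha> \<in> khom x y" and \<beta>: "\<beta> \<in> khom y z" and u: "u \<in> obj N x"
    then obtain v where "u = f x v" "v \<in> obj M x"
      by (auto simp: N_def)
    then show "arr N x z (\<beta> * \<alpha>) u = arr N y z \<beta> (arr N x y \<alpha> u)"
      using arr_comp[OF \<alpha> \<beta>] kmod_arr[OF M \<alpha>] by (simp add: N_def inv)
  qed
  have "kmod_hom M N f"
    using lin by (auto simp: kmod_hom_def linmap_def N_def inv)
  moreover have "bij_betw (f x) (obj M x) (obj N x)" for x
    using inj by (simp add: bij_betw_def N_def)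
  ultimately show "kmod_iso M N"
    unfolding kmod_iso_iff by blast
qed

text \<open>Coordinates with respect to a finite basis, padded with zeros to a sequence.\<close>

lemma exists_coordinates:
  fixes s :: "'k::field \<Rightarrow> 'v::ab_group_add \<Rightarrow> 'v"
  assumes "vector_space s" "fin_dim s V"
  shows "\<exists>f :: 'v \<Rightarrow> nat \<Rightarrow> 'k. linmap s V (\<lambda>c u i. c * u i) UNIV f \<and> inj_on f V"
proof -
  interpret vector_space s by fact
  obtain B where B: "B \<subseteq> V" "independent B" "V \<subseteq> span B"
    by (rule basis_exists)
  then have "finite B"
    using independent_finite_in_fin_dim assms(2) by blast
  then obtain e where e: "bij_betw e {..<card B} B"
    using ex_bij_betw_nat_finite by (metis atLeast0LessThan)
  define f where "f v i = (if i < card B then representation B v (e i) else 0)" for v i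
  have span: "v \<in> span B" if "v \<in> V" for v
    using that B by blast
  have "linmap s V (\<lambda>c u i. c * u i) UNIV f"
    by (auto simp: linmap_def f_def fun_eq_iff span representation_add[OF B(2)]
        representation_scale[OF B(2)])
  moreover have "inj_on f V"
  proof (rule inj_onI)
    fix u v assume uv: "u \<in> V" "v \<in> V" "f u = f v"
    have "representation B u b = representation B v b" for b
    proof (cases "b \<in> B")
      case True
      then obtain i where "i < card B" "b = e i"
        using e by (auto simp: bij_betw_def)
      then show ?thesis
        using fun_cong[OF uv(3), of i] by (simp add: f_def)
    next
      case False
      then show ?thesis
        using representation_ne_zero[of B] by metis
    qed
    then have "(\<Sum>b | representation B u b \<noteq> 0. s (representation B u b) b)
        = (\<Sum>b | representation B v b \<noteq> 0. s (representation B v b) b)"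
      by simp
    then show "u = v"
      unfolding sum_nonzero_representation_eq[OF B(2) span[OF uv(1)]]
        sum_nonzero_representation_eq[OF B(2) span[OF uv(2)]] .
  qed
  ultimately show ?thesis
    by blast
qed

text \<open>\<open>multiplicity_matrix\<close> tests its rank formula on modules over
  \<open>nat \<Rightarrow> 'k\<close>; this makes the formula available for every module up to
  isomorphism.\<close>

lemma exists_coordinate_kmod:
  fixes M :: "('k::field, 'v::ab_group_add, 's::order) kmod"
  assumes "is_kmod M"
  shows "\<exists>N :: ('k, nat \<Rightarrow> 'k, 's) kmod. is_kmod N \<and> kmod_iso M N"
proof -
  have "\<exists>f :: 'v \<Rightarrow> nat \<Rightarrow> 'k. linmap (scl M) (obj M x) (\<lambda>c u i. c * u i) UNIV f \<and>
      inj_on f (obj M x)" for x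
    using exists_coordinates[OF kmod_vector_space kmod_fin_dim] assms by blast
  then obtain f :: "'s \<Rightarrow> 'v \<Rightarrow> nat \<Rightarrow> 'k"
    where f: "\<And>x. linmap (scl M) (obj M x) (\<lambda>c u i. c * u i) UNIV (f x)"
      "\<And>x. inj_on (f x) (obj M x)"
    by metis
  have "vector_space (\<lambda>c (u :: nat \<Rightarrow> 'k) i. c * u i)"
    by (rule vector_space_fun) (simp add: vector_space_def algebra_simps)
  then show ?thesis
    using kmod_transport[OF assms _ f] by blast
qed


section \<open>Ranks of morphisms of the additive hull\<close>

abbreviation (input) fun_scl :: "('k \<Rightarrow> 'v \<Rightarrow> 'v) \<Rightarrow> 'k \<Rightarrow> (nat \<Rightarrow> 'v) \<Rightarrow> nat \<Rightarrow> 'v" where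
  "fun_scl s \<equiv> \<lambda>c v i. s c (v i)"

lemma is_hmor_entry:
  assumes "is_hmor a" "j < length (hcod a)" "i < length (hdom a)"
  shows "hmat a $$ (j, i) \<in> khom (hdom a ! i) (hcod a ! j)"
  using assms by (simp add: is_hmor_def)

lemma fin_dim_hull_obj:
  assumes M: "is_kmod M"
  shows "fin_dim (fun_scl (scl M)) (hull_obj M X)"
  unfolding hull_obj_def by (rule fin_dim_fun[OF kmod_vector_space[OF M] kmod_fin_dim[OF M]])

lemma linmap_hull_map:
  fixes M :: "('k::field, 'v::ab_group_add, 's::order) kmod"
  assumes M: "is_kmod M" and a: "is_hmor a"
  shows "linmap (fun_scl (scl M)) (hull_obj M (hdom a)) (fun_scl (scl M)) UNIV (hull_map M a)"
proof -
  have "arr M (hdom a ! i) (hcod a ! j) (hmat a $$ (j, i)) (u i + v i) =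
      arr M (hdom a ! i) (hcod a ! j) (hmat a $$ (j, i)) (u i) +
      arr M (hdom a ! i) (hcod a ! j) (hmat a $$ (j, i)) (v i)"
    "arr M (hdom a ! i) (hcod a ! j) (hmat a $$ (j, i)) (scl M c (u i)) =
      scl M c (arr M (hdom a ! i) (hcod a ! j) (hmat a $$ (j, i)) (u i))"
    if "u \<in> hull_obj M (hdom a)" "v \<in> hull_obj M (hdom a)"
      "i < length (hdom a)" "j < length (hcod a)" for u v i j c
    using kmod_linmap[OF M is_hmor_entry[OF a that(4,3)]] that
    by (auto simp: linmap_def hull_obj_def)
  then show ?thesis
    unfolding linmap_def hull_map_def
    by (auto simp: fun_eq_iff sum.distrib kmod_scl_sum[OF M] kmod_scl_zero[OF M])
qed

text \<open>With \<open>a\<close> a lower block matrix and \<open>b\<close> its diagonal part, this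
  restates the equality of their ranks in a form open to diagram chases.\<close>

definition kernel_in_image ::
  "('k::field, 'v::ab_group_add, 's::order) kmod \<Rightarrow> ('k, 's) hmor \<Rightarrow> ('k, 's) hmor \<Rightarrow> bool" where
  "kernel_in_image M a b \<longleftrightarrow>
     (\<forall>u\<in>hull_obj M (hdom b). hull_map M b u = 0 \<longrightarrow>
       hull_map M a u \<in> hull_map M b ` hull_obj M (hdom b))"

text \<open>
  Truncation to the first \<open>q\<close> coordinates maps the images of \<open>a\<close> and \<open>b\<close> onto the same space, so
  that by rank-nullity only the kernels of the truncation on the two images have to be compared.
\<close>

lemma hull_rank_eq_iff:
  fixes M :: "('k::field, 'v::ab_group_add, 's::order) kmod"
  assumes M: "is_kmod M" and a: "is_hmor a" and b: "is_hmor b"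
    and dom: "hdom a = hdom b" and cod: "hcod a = hcod b"
    and upper: "\<And>j i. j < length (hcod b) \<Longrightarrow> i < length (hdom b) \<Longrightarrow> j < q \<Longrightarrow> p \<le> i \<Longrightarrow>
      hmat b $$ (j, i) = 0"
    and lower: "\<And>j i. j < length (hcod b) \<Longrightarrow> i < length (hdom b) \<Longrightarrow> q \<le> j \<Longrightarrow> i < p \<Longrightarrow>
      hmat b $$ (j, i) = 0"
    and eq: "\<And>j i. j < length (hcod b) \<Longrightarrow> i < length (hdom b) \<Longrightarrow> j < q \<or> p \<le> i \<Longrightarrow>
      hmat a $$ (j, i) = hmat b $$ (j, i)"
  shows "hull_rank M a = hull_rank M b \<longleftrightarrow> kernel_in_image M a b"
proof -
  let ?S = "fun_scl (scl M)"
  have S: "vector_space ?S"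
    using vector_space_fun kmod_vector_space[OF M] .
  interpret vector_space ?S
    by (rule S)
  let ?U = "hull_obj M (hdom b)"
  let ?F = "hull_map M a" and ?D = "hull_map M b"
  \<comment> \<open>\<open>p\<close> and \<open>q\<close> mark the ends of the first column block
    and the first row block: \<open>P\<close> and \<open>P'\<close> split the domain into its two
    summands, and \<open>Q\<close> keeps the first summand of the codomain.\<close>
  define Q :: "(nat \<Rightarrow> 'v) \<Rightarrow> nat \<Rightarrow> 'v" where "Q e j = (if j < q then e j else 0)" for e j
  define P :: "(nat \<Rightarrow> 'v) \<Rightarrow> nat \<Rightarrow> 'v" where "P u i = (if i < p then u i else 0)" for u i
  define P' :: "(nat \<Rightarrow> 'v) \<Rightarrow> nat \<Rightarrow> 'v" where "P' u i = (if i < p then 0 else u i)" for u i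
  let ?arr = "\<lambda>j i. arr M (hdom b ! i) (hcod b ! j)"
  have linF: "linmap ?S ?U ?S UNIV ?F" and linD: "linmap ?S ?U ?S UNIV ?D"
    using linmap_hull_map[OF M a] linmap_hull_map[OF M b] dom by simp_all
  have fdF: "fin_dim ?S (?F ` ?U)" and fdD: "fin_dim ?S (?D ` ?U)"
    using fin_dim_image[OF S S _ fin_dim_hull_obj[OF M]] linF linD by blast+
  have U: "subspace ?U"
    using fin_dim_hull_obj[OF M] fin_dim_subspace by blast
  have PU: "P u \<in> ?U" "P' u \<in> ?U" if "u \<in> ?U" for u
    using that kmod_zero[OF M] by (auto simp: hull_obj_def P_def P'_def)
  have split: "u = P u + P' u" for u
    by (auto simp: P_def P'_def fun_eq_iff)
  have Fs: "?F u = ?F (P u) + ?F (P' u)" and Ds: "?D u = ?D (P u) + ?D (P' u)" if "u \<in> ?U" for u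
    using split[of u] PU[OF that] linF linD unfolding linmap_def by metis+
  have arr0: "?arr j i 0 (u i) = 0" "?arr j i (hmat b $$ (j, i)) 0 = 0"
    if "u \<in> ?U" "i < length (hdom b)" "j < length (hcod b)" for u i j
    using that kmod_arr_scalar_zero[OF M] kmod_arr_zero[OF M is_hmor_entry[OF b that(3,2)]]
    by (auto simp: hull_obj_def)
  \<comment> \<open>Both matrices have the same upper rows, supported on the first \<open>p\<close>
    columns. In \<open>b\<close> these columns are zero below row \<open>q\<close>, so truncating
    amounts to applying \<open>b\<close> to \<open>P u\<close>.\<close>
  have QF: "Q (?F u) = ?D (P u)" and QD: "Q (?D u) = ?D (P u)" if u: "u \<in> ?U" for u
  proof -
    have t: "?arr j i (hmat a $$ (j, i)) (u i) = ?arr j i (hmat b $$ (j, i)) (P u i)"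
      "?arr j i (hmat b $$ (j, i)) (u i) = ?arr j i (hmat b $$ (j, i)) (P u i)"
      if "i < length (hdom b)" "j < length (hcod b)" "j < q" for i j
      using arr0[OF u that(1,2)] upper[OF that(2,1,3)] eq[OF that(2,1)] that(3)
      by (auto simp: P_def)
    have z: "?arr j i (hmat b $$ (j, i)) (P u i) = 0"
      if "i < length (hdom b)" "j < length (hcod b)" "\<not> j < q" for i j
      using arr0[OF PU(1)[OF u] that(1,2)] arr0[OF u that(1,2)] lower[OF that(2,1)] that(3)
      by (auto simp: P_def)
    show "Q (?F u) = ?D (P u)" "Q (?D u) = ?D (P u)"
      by (auto simp: fun_eq_iff Q_def hull_map_def dom cod t z)
  qed
  have FD: "?F (P' u) = ?D (P' u)" if u: "u \<in> ?U" for u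
  proof -
    have "?arr j i (hmat a $$ (j, i)) (P' u i) = ?arr j i (hmat b $$ (j, i)) (P' u i)"
      if "i < length (hdom b)" "j < length (hcod b)" for i j
    proof (cases "i < p")
      case True
      then show ?thesis
        using kmod_arr_zero[OF M] is_hmor_entry[OF a] is_hmor_entry[OF b] that dom cod
        by (simp add: P'_def)
    next
      case False
      then show ?thesis
        using eq that by simp
    qed
    then show ?thesis
      by (auto simp: fun_eq_iff hull_map_def dom cod)
  qed
  have D0: "?D 0 = 0"
    using linmap_zero[OF linD] subspace_0[OF U] by blast
  have "Vector_Spaces.linear ?S ?S Q"
    by unfold_locales (auto simp: Q_def fun_eq_iff kmod_scl_zero[OF M])
  moreover have "Q ` ?F ` ?U = Q ` ?D ` ?U"
    using QF QD by (simp add: image_image cong: image_cong)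
  moreover have "{w \<in> ?D ` ?U. Q w = 0} \<subseteq> ?F ` ?U"
  proof
    fix w assume "w \<in> {w \<in> ?D ` ?U. Q w = 0}"
    then obtain u where u: "u \<in> ?U" "w = ?D u" "?D (P u) = 0"
      using QD by auto
    then have "w = ?F (P' u)"
      using Ds FD by simp
    then show "w \<in> ?F ` ?U"
      using PU(2) u(1) by blast
  qed
  ultimately have "dim (?F ` ?U) = dim (?D ` ?U) \<longleftrightarrow> {v \<in> ?F ` ?U. Q v = 0} \<subseteq> ?D ` ?U"
    by (rule dim_eq_iff_kernel_subset[OF fdF fdD])
  also have "\<dots> \<longleftrightarrow> kernel_in_image M a b"
  proof
    assume l: "{v \<in> ?F ` ?U. Q v = 0} \<subseteq> ?D ` ?U"
    show "kernel_in_image M a b"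
      unfolding kernel_in_image_def
    proof (intro ballI impI)
      fix u assume u: "u \<in> ?U" "?D u = 0"
      have "Q 0 = 0"
        by (simp add: Q_def fun_eq_iff)
      then have "?F u \<in> {v \<in> ?F ` ?U. Q v = 0}"
        using QF[OF u(1)] QD[OF u(1)] u by simp
      then show "?F u \<in> ?D ` ?U"
        by (rule subsetD[OF l])
    qed
  next
    assume r: "kernel_in_image M a b"
    show "{v \<in> ?F ` ?U. Q v = 0} \<subseteq> ?D ` ?U"
    proof
      fix v assume "v \<in> {v \<in> ?F ` ?U. Q v = 0}"
      then obtain u where u: "u \<in> ?U" "v = ?F u" "?D (P u) = 0"
        using QF by auto
      \<comment> \<open>Here \<open>P u\<close> lies in the kernel of \<open>b\<close>, where the
        criterion applies; on \<open>P' u\<close> the two maps agree by \<open>FD\<close>.\<close>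
      have "?F (P u) \<in> ?D ` ?U"
        using r PU(1)[OF u(1)] u(3) by (simp add: kernel_in_image_def)
      then obtain z where z: "z \<in> ?U" "?F (P u) = ?D z"
        by auto
      have "v = ?D z + ?D (P' u)"
        using Fs[OF u(1)] FD[OF u(1)] z(2) u(2) by simp
      also have "\<dots> = ?D (z + P' u)"
        using linD z(1) PU(2)[OF u(1)] by (simp add: linmap_def)
      finally show "v \<in> ?D ` ?U"
        using subspace_add[OF U z(1) PU(2)[OF u(1)]] by blast
    qed
  qed
  finally show ?thesis
    by (simp add: hull_rank_def dom)
qed

section \<open>The kernel criterion under homomorphisms and restriction\<close>

lemma hull_map_natural:
  assumes f: "kmod_hom M N f" and M: "is_kmod M" and a: "is_hmor a"
    and u: "u \<in> hull_obj M (hdom a)"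
  shows "hull_map N a (\<lambda>i. if i < length (hdom a) then f (hdom a ! i) (u i) else 0) =
    (\<lambda>j. if j < length (hcod a) then f (hcod a ! j) (hull_map M a u j) else 0)"
proof
  fix j
  show "hull_map N a (\<lambda>i. if i < length (hdom a) then f (hdom a ! i) (u i) else 0) j =
    (if j < length (hcod a) then f (hcod a ! j) (hull_map M a u j) else 0)"
  proof (cases "j < length (hcod a)")
    case True
    let ?arr = "\<lambda>M i. arr M (hdom a ! i) (hcod a ! j) (hmat a $$ (j, i))"
    have ui: "u i \<in> obj M (hdom a ! i)" if "i < length (hdom a)" for i
      using u that by (simp add: hull_obj_def)
    have "f (hcod a ! j) (\<Sum>i<length (hdom a). ?arr M i (u i))
        = (\<Sum>i<length (hdom a). f (hcod a ! j) (?arr M i (u i)))"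
      using kmod_arr[OF M is_hmor_entry[OF a True] ui] by (intro kmod_hom_sum[OF f M]) simp
    also have "\<dots> = (\<Sum>i<length (hdom a). ?arr N i (f (hdom a ! i) (u i)))"
      using kmod_hom_arr[OF f is_hmor_entry[OF a True] ui] by (intro sum.cong) auto
    finally show ?thesis
      using True by (simp add: hull_map_def)
  qed (simp add: hull_map_def)
qed

lemma hull_map_in:
  assumes "is_kmod M" "is_hmor a" "u \<in> hull_obj M (hdom a)"
  shows "hull_map M a u \<in> hull_obj M (hcod a)"
proof -
  have "arr M (hdom a ! i) (hcod a ! j) (hmat a $$ (j, i)) (u i) \<in> obj M (hcod a ! j)"
    if "i < length (hdom a)" "j < length (hcod a)" for i j
    using kmod_arr[OF assms(1) is_hmor_entry[OF assms(2)]] that assms(3) by (simp add: hull_obj_def)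
  then show ?thesis
    by (auto simp: hull_obj_def hull_map_def intro!: kmod_sum[OF assms(1)])
qed

text \<open>A kernel vector is sent to \<open>N\<close> by \<open>f\<close>, the criterion there
  supplies a preimage \<open>w\<close> under \<open>b\<close>, and \<open>g\<close> brings
  \<open>w\<close> back while cancelling \<open>f\<close> on the value of \<open>a\<close>.\<close>

lemma kernel_in_image_retract:
  assumes A: "is_kmod A" and N: "is_kmod N" and a: "is_hmor a" and b: "is_hmor b"
    and dom: "hdom a = hdom b" and cod: "hcod a = hcod b"
    and "retract A N" and ker: "kernel_in_image N a b"
  shows "kernel_in_image A a b"
proof -
  obtain f g where f: "kmod_hom A N f" and g: "kmod_hom N A g"
    and gf: "\<And>x v. v \<in> obj A x \<Longrightarrow> g x (f x v) = v"
    using assms(7) unfolding retract_def by blast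
  define F where "F X u i = (if i < length X then f (X ! i) (u i) else 0)" for X u i
  define G where "G X u i = (if i < length X then g (X ! i) (u i) else 0)" for X u i
  have F: "F X u \<in> hull_obj N X" and GF: "G X (F X u) = u" if "u \<in> hull_obj A X" for X u
    using that kmod_hom_in[OF f] gf by (auto simp: F_def G_def hull_obj_def fun_eq_iff)
  have G: "G X u \<in> hull_obj A X" if "u \<in> hull_obj N X" for X u
    using that kmod_hom_in[OF g] by (auto simp: G_def hull_obj_def)
  have natF: "hull_map N c (F (hdom c) u) = F (hcod c) (hull_map A c u)"
    if "is_hmor c" "u \<in> hull_obj A (hdom c)" for c u
    using hull_map_natural[OF f A that] by (simp add: F_def[abs_def])
  have natG: "hull_map A c (G (hdom c) u) = G (hcod c) (hull_map N c u)"
    if "is_hmor c" "u \<in> hull_obj N (hdom c)" for c u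
    using hull_map_natural[OF g N that] by (simp add: G_def[abs_def])
  show ?thesis
    unfolding kernel_in_image_def
  proof (intro ballI impI)
    fix u assume u: "u \<in> hull_obj A (hdom b)" "hull_map A b u = 0"
    have "hull_map N b (F (hdom b) u) = 0"
      using natF[OF b u(1)] u(2) kmod_hom_zero[OF f kmod_zero[OF A]] by (auto simp: F_def fun_eq_iff)
    then obtain w where w: "w \<in> hull_obj N (hdom b)" "hull_map N a (F (hdom b) u) = hull_map N b w"
      using ker F[OF u(1)] unfolding kernel_in_image_def by blast
    have ua: "u \<in> hull_obj A (hdom a)"
      using u(1) dom by simp
    have "hull_map A a u = G (hcod b) (F (hcod b) (hull_map A a u))"
      using GF[OF hull_map_in[OF A a ua]] cod by simp
    also have "\<dots> = G (hcod b) (hull_map N b w)"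
      using natF[OF a ua] w(2) dom cod by simp
    also have "\<dots> = hull_map A b (G (hdom b) w)"
      using natG[OF b w(1)] by simp
    finally show "hull_map A a u \<in> hull_map A b ` hull_obj A (hdom b)"
      using G[OF w(1)] by blast
  qed
qed

text \<open>Since \<open>hull_push\<close> keeps the matrix of scalars, the restricted module
  evaluates a morphism to the very map that \<open>M\<close> assigns to its push.\<close>

lemma kernel_in_image_restrict:
  "kernel_in_image (restrict_kmod \<zeta> M) a b \<longleftrightarrow>
    kernel_in_image M (hull_push \<zeta> a) (hull_push \<zeta> b)"
proof -
  have "hull_obj (restrict_kmod \<zeta> M) X = hull_obj M (map \<zeta> X)" for X
    by (auto simp: hull_obj_def restrict_kmod_def)
  moreover have "hull_map (restrict_kmod \<zeta> M) c = hull_map M (hull_push \<zeta> c)" for c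
    by (auto simp: hull_map_def restrict_kmod_def hull_push_def fun_eq_iff)
  ultimately show ?thesis
    by (simp add: kernel_in_image_def hull_push_def)
qed


section \<open>Restriction\<close>

lemma kmod_hom_restrict:
  fixes M :: "('k::field, 'v::ab_group_add, 'p::order) kmod" and \<zeta> :: "'z::order \<Rightarrow> 'p"
  assumes "kmod_hom M N f" "mono \<zeta>"
  shows "kmod_hom (restrict_kmod \<zeta> M) (restrict_kmod \<zeta> N) (\<lambda>x. f (\<zeta> x))"
proof -
  have "\<alpha> \<in> khom (\<zeta> x) (\<zeta> y)" if "\<alpha> \<in> khom x y" for \<alpha> :: 'k and x y
    using that monoD[OF assms(2), of x y] by (cases "x \<le> y") (simp_all add: khom_def)
  then show ?thesis
    using assms(1) by (simp add: kmod_hom_def restrict_kmod_def)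
qed

lemma retract_restrict:
  assumes "retract A N" "mono \<zeta>"
  shows "retract (restrict_kmod \<zeta> A) (restrict_kmod \<zeta> N)"
proof -
  obtain f g where f: "kmod_hom A N f" and g: "kmod_hom N A g"
    and gf: "\<And>x v. v \<in> obj A x \<Longrightarrow> g x (f x v) = v"
    using assms(1) unfolding retract_def by blast
  show ?thesis
    unfolding retract_def
    using kmod_hom_restrict[OF f assms(2)] kmod_hom_restrict[OF g assms(2)] gf
    by (intro exI[of _ "\<lambda>x. f (\<zeta> x)"] exI[of _ "\<lambda>x. g (\<zeta> x)"] conjI)
      (simp_all add: restrict_kmod_def)
qed

lemma kmod_iso_restrict_dsum2:
  assumes "kmod_iso M (dsum2 (dsum n (\<lambda>_. A)) N)" "mono \<zeta>"
  shows "kmod_iso (restrict_kmod \<zeta> M)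
    (dsum2 (dsum n (\<lambda>_. restrict_kmod \<zeta> A)) (restrict_kmod \<zeta> N))"
proof -
  obtain f where f: "kmod_hom M (dsum2 (dsum n (\<lambda>_. A)) N) f"
    "\<And>x. bij_betw (f x) (obj M x) (obj (dsum2 (dsum n (\<lambda>_. A)) N) x)"
    using assms(1) unfolding kmod_iso_iff by blast
  have eq: "restrict_kmod \<zeta> (dsum2 (dsum n (\<lambda>_. A)) N) =
      dsum2 (dsum n (\<lambda>_. restrict_kmod \<zeta> A)) (restrict_kmod \<zeta> N)"
    by (simp add: restrict_kmod_def dsum2_def dsum_def fun_eq_iff)
  show ?thesis
    unfolding kmod_iso_iff
  proof (intro exI conjI allI)
    show "kmod_hom (restrict_kmod \<zeta> M)
        (dsum2 (dsum n (\<lambda>_. restrict_kmod \<zeta> A)) (restrict_kmod \<zeta> N)) (\<lambda>x. f (\<zeta> x))"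
      using kmod_hom_restrict[OF f(1) assms(2)] unfolding eq .
    show "bij_betw (f (\<zeta> x)) (obj (restrict_kmod \<zeta> M) x)
        (obj (dsum2 (dsum n (\<lambda>_. restrict_kmod \<zeta> A)) (restrict_kmod \<zeta> N)) x)" for x
      using f(2)[of "\<zeta> x"] unfolding eq[symmetric] by (simp add: restrict_kmod_def)
  qed
qed

text \<open>
  If the two ranks of a covered multiplicity matrix agree on \<open>M\<close>, which means that \<open>V\<^sub>I\<close> is not a
  summand of \<open>M\<close>, then the criterion \<open>kernel_in_image\<close> holds for the lifted matrix on the
  restriction of \<open>M\<close>.  It would pass to the retract \<open>restrict_kmod \<zeta> V\<^sub>I\<close>, and hence back to \<open>V\<^sub>I\<close>.
\<close>

lemma essentially_covers_not_retract:
  fixes M :: "('k::field, 'v::ab_group_add, 'p::{finite, order}) kmod"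
    and I :: "'p set" and \<zeta> :: "'z::order \<Rightarrow> 'p"
  defines "V \<equiv> interval_module I :: ('k, 'k, 'p) kmod"
  assumes M: "is_kmod M" and I: "interval I" and \<zeta>: "mono \<zeta>"
    and ess: "essentially_covers TYPE('k) \<zeta> I" and not_retract: "\<not> retract V M"
  shows "\<not> retract (restrict_kmod \<zeta> V) (restrict_kmod \<zeta> M)"
proof
  assume ret: "retract (restrict_kmod \<zeta> V) (restrict_kmod \<zeta> M)"
  have V: "is_kmod V"
    unfolding V_def using is_kmod_interval_module[OF I] .
  obtain X X' Y Y' and g\<^sub>1 g\<^sub>3 g\<^sub>2 :: "'k mat" where mm: "multiplicity_matrix I X X' Y Y' g\<^sub>1 g\<^sub>3 g\<^sub>2"
    and cov: "covers \<zeta> (lower_block X X' Y Y' g\<^sub>1 g\<^sub>3 g\<^sub>2)"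
    using ess unfolding essentially_covers_def by (elim exE conjE)
  let ?Z = "0\<^sub>m (length Y') (length X)"
  define a where "a = lower_block X X' Y Y' g\<^sub>1 g\<^sub>3 g\<^sub>2"
  define b where "b = lower_block X X' Y Y' g\<^sub>1 ?Z g\<^sub>2"
  have g: "g\<^sub>1 \<in> carrier_mat (length Y) (length X)" "g\<^sub>3 \<in> carrier_mat (length Y') (length X)"
    "g\<^sub>2 \<in> carrier_mat (length Y') (length X')" and a: "is_hmor a"
    using mm by (simp_all add: multiplicity_matrix_def a_def)
  have rank: "int (summand_mult N V) = int (hull_rank N a) - int (hull_rank N b)"
    if "is_kmod N" for N :: "('k, nat \<Rightarrow> 'k, 'p) kmod"
    using mm that unfolding multiplicity_matrix_def a_def b_def V_def by blast
  have dom: "hdom a = hdom b" "hdom b = X @ X'" and cod: "hcod a = hcod b" "hcod b = Y @ Y'"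
    by (simp_all add: a_def b_def lower_block_def)
  \<comment> \<open>Passing to \<open>b\<close> deletes the lower left block; the upper right block
    is already zero in \<open>a\<close>.\<close>
  have entries: "hmat b $$ (j, i) = (if j < length Y \<longleftrightarrow> i < length X then hmat a $$ (j, i) else 0)"
    "j < length Y \<Longrightarrow> length X \<le> i \<Longrightarrow> hmat a $$ (j, i) = 0"
    if "j < length (hcod b)" "i < length (hdom b)" for j i
    using that g by (auto simp: a_def b_def lower_block_def)
  have b: "is_hmor b"
  proof -
    have "hmat b \<in> carrier_mat (length (hcod b)) (length (hdom b))"
      using g by (auto simp: b_def lower_block_def)
    then show ?thesis
      using a entries(1) unfolding is_hmor_def dom(1) cod(1) by simp
  qed
  have rank_iff: "hull_rank N a = hull_rank N b \<longleftrightarrow> kernel_in_image N a b"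
    if "is_kmod N" for N :: "('k, nat \<Rightarrow> 'k, 'p) kmod"
    by (rule hull_rank_eq_iff[OF that a b dom(1) cod(1), of "length Y" "length X"])
      (auto simp: entries)
  obtain a' :: "('k, 'z) hmor" where a': "is_hmor a'" "hull_push \<zeta> a' = a"
    using cov unfolding covers_def a_def by blast
  \<comment> \<open>The objects that lift those of \<open>a\<close> also serve for \<open>b\<close>:
    entries are either kept or replaced by 0, which is a morphism between any two points.\<close>
  define b' where "b' = a'\<lparr>hmat := hmat b\<rparr>"
  have dom': "hdom a' = hdom b'" and cod': "hcod a' = hcod b'"
    by (simp_all add: b'_def)
  have a'_eq: "hdom a = map \<zeta> (hdom a')" "hcod a = map \<zeta> (hcod a')" "hmat a = hmat a'"
    using a'(2) by (auto simp: hull_push_def)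
  have push_b': "hull_push \<zeta> b' = b"
    using a'_eq dom(1) cod(1) by (simp add: hull_push_def b'_def)
  have hb: "hdom b = map \<zeta> (hdom a')" "hcod b = map \<zeta> (hcod a')"
    using a'_eq(1,2) dom(1) cod(1) by simp_all
  have "hmat b $$ (j, i) \<in> khom (hdom a' ! i) (hcod a' ! j)"
    if "j < length (hcod a')" "i < length (hdom a')" for j i
    using entries(1)[of j i] is_hmor_entry[OF a'(1) that] that a'_eq(3) hb by simp
  moreover have "hmat b \<in> carrier_mat (length (hcod a')) (length (hdom a'))"
    using b hb by (simp add: is_hmor_def)
  ultimately have b': "is_hmor b'"
    by (simp add: is_hmor_def b'_def)
  \<comment> \<open>The rank formula is stated over \<open>nat \<Rightarrow> 'k\<close>, so
    \<open>M\<close> and \<open>V\<close> are replaced by isomorphic copies there.\<close>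
  obtain TM :: "('k, nat \<Rightarrow> 'k, 'p) kmod" where TM: "is_kmod TM" "kmod_iso M TM"
    using exists_coordinate_kmod[OF M] by blast
  obtain TV :: "('k, nat \<Rightarrow> 'k, 'p) kmod" where TV: "is_kmod TV" "kmod_iso V TV"
    using exists_coordinate_kmod[OF V] by blast
  have iff: "1 \<le> summand_mult N V \<longleftrightarrow> retract V N" if "is_kmod N" for N :: "('k, nat \<Rightarrow> 'k, 'p) kmod"
    using copies_iff_le_summand_mult[OF that I, of 1] copies_1[of V N] by (simp add: V_def)
  have "\<not> retract V TM"
    using retract_trans[OF _ kmod_iso_retract(2)[OF TM(2) M]] not_retract by metis
  then have "hull_rank TM a = hull_rank TM b"
    using iff[OF TM(1)] rank[OF TM(1)] by simp
  then have "kernel_in_image (restrict_kmod \<zeta> TM) a' b'"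
    using rank_iff[OF TM(1)] by (simp add: kernel_in_image_restrict a'(2) push_b')
  moreover have "retract (restrict_kmod \<zeta> TV) (restrict_kmod \<zeta> TM)"
    using retract_trans[OF retract_trans[OF retract_restrict[OF kmod_iso_retract(2)[OF TV(2) V] \<zeta>] ret]
        retract_restrict[OF kmod_iso_retract(1)[OF TM(2) M] \<zeta>]] .
  ultimately have "kernel_in_image (restrict_kmod \<zeta> TV) a' b'"
    using kernel_in_image_retract[OF is_kmod_restrict_kmod[OF TV(1) \<zeta>]
        is_kmod_restrict_kmod[OF TM(1) \<zeta>] a'(1) b' dom' cod'] by blast
  then have "hull_rank TV a = hull_rank TV b"
    using rank_iff[OF TV(1)] by (simp add: kernel_in_image_restrict a'(2) push_b')
  \<comment> \<open>Equal ranks would make the multiplicity of \<open>V\<close> in \<open>TV\<close>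
    zero, although \<open>TV\<close> is isomorphic to \<open>V\<close>.\<close>
  then show False
    using iff[OF TV(1)] rank[OF TV(1)] kmod_iso_retract(1)[OF TV(2) V] by simp
qed

theorem mainTheorem3:
  fixes M :: "('k::field, 'v::ab_group_add, 'p::{finite, order}) kmod"
    and I :: "'p set"
    and \<zeta> :: "'z::order \<Rightarrow> 'p"
  assumes "is_kmod M"
    and "interval I"
    and "mono \<zeta>"
    and "essentially_covers TYPE('k) \<zeta> I"
  shows "summand_mult M (interval_module I :: ('k, 'k, 'p) kmod) =
    bar_summand_mult (restrict_kmod \<zeta> M) (restrict_kmod \<zeta> (interval_module I :: ('k, 'k, 'p) kmod))"
proof -
  let ?V = "interval_module I :: ('k, 'k, 'p) kmod"
  let ?n = "summand_mult M ?V"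
  have V: "is_kmod ?V"
    using is_kmod_interval_module[OF assms(2)] .
  \<comment> \<open>The multiplicity is the largest number of copies, so \<open>copies_split\<close>
    takes off exactly that many and leaves a complement without a further one.\<close>
  have "copies ?V M ?n" "\<not> copies ?V M (Suc ?n)"
    using copies_iff_le_summand_mult[OF assms(1,2)] by simp_all
  then obtain M' :: "('k, 'v, 'p) kmod" where M': "is_kmod M'"
    "kmod_iso M (dsum2 (dsum ?n (\<lambda>_. ?V)) M')" "\<not> retract ?V M'"
    by (rule copies_split[OF assms(1) V])
  have "is_kmod (restrict_kmod \<zeta> ?V)"
    using is_kmod_restrict_kmod[OF V assms(3)] .
  \<comment> \<open>The decomposition restricts termwise. As \<open>?V\<close> restricts to
    \<open>interval_module\<close> of the preimage of \<open>I\<close>, it has the form that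
    \<open>bar_summand_mult_eq\<close> evaluates.\<close>
  then show ?thesis
    using bar_summand_mult_eq[OF is_kmod_restrict_kmod[OF assms(1,3)] _
        is_kmod_restrict_kmod[OF M'(1) assms(3)], of "\<zeta> -` I" ?n]
      kmod_iso_restrict_dsum2[OF M'(2) assms(3)]
      essentially_covers_not_retract[OF M'(1) assms(2-4) M'(3)]
    by (simp add: restrict_interval_module)
qed

end
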